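(* Assume that $\mathcal G$ is connected, and that $\overline{\mathcal G}$ is weakly connected and compact. Suppose $\Omega,E_1,E_2$ are nonempty clopen subsets of $\partial\overline{\mathcal G}$ with $\Omega\neq\partial\overline{\mathcal G}$, $E_1\subset\Omega$, and $E_2\subset\partial\overline{\mathcal G}\setminus\Omega$. Then $$\Lambda_q(1_\Omega,E_1)>0,\qquad \Lambda_q(1_\Omega,E_2)\le 0 .$$ If $q(x)=0$ for all $x$ in some neighborhood of $\partial\overline{\mathcal G}$, then $\Lambda_q(1_\Omega,E_2)<0$.
   Context: A metric graph $\mathcal G$ is a locally finite graph with countable vertex set and edge set $\mathcal E$, without loops or multiple edges, in which each edge is identified with a real interval of finite positive length; Lebesgue measure on the intervals gives a measure on $\mathcal G$. The distance $d(p_1,p_2)$ is the infimum of lengths of paths joining $p_1$ and $p_2$; $\overline{\mathcal G}$ is the metric completion. $\partial\mathcal G$ is the set of vertices of degree one and $\partial\overline{\mathcal G}=\partial\mathcal G\cup(\overline{\mathcal G}\setminus\mathcal G)$. $\overline{\mathcal G}$ is weakly connected if for every pair of distinct points $x,y\in\overline{\mathcal G}$ there is a finite set of points $W\subset\mathcal G$ and disjoint open sets $U,V$ with $\overline{\mathcal G}\setminus W=U\cup V$, $x\in U$, $y\in V$. Clopen means both closed and open (here relative to $\partial\overline{\mathcal G}$). A function $u:\mathcal G\to\mathbb R$ is $q$-harmonic if on each edge $u'$ is absolutely continuous and $u''=qu$ a.e., and at each vertex $v$ of degree at least $2$, $u$ is continuous and $\sum_{e(i)\sim v}\partial_\nu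 u_i(v)=0$, where $u_i$ is the restriction of $u$ to the incident edge $e(i)$ and $\partial_\nu u_i(v)$ is the derivative at $v$ in the local coordinate identifying $e(i)$ with $[a,b]$ so that $a$ corresponds to $v$. $\mathcal A$ is the algebra of functions $\phi:\overline{\mathcal G}\to\mathbb R$ which are continuous, infinitely differentiable on the open edges of $\mathcal G$, and for which $\phi'(x)=0$ for all $x$ in the complement of a finite set of edges and in a neighborhood of each vertex of $\mathcal G$. Standing assumptions: $\partial\overline{\mathcal G}\ne\emptyset$; $q:\mathcal G\to\mathbb R$ is nonnegative, locally integrable, and integrable over $\mathcal G$; and there is a weight $\omega:\mathcal E\to(0,\infty)$ with $\sum_e\omega(e)<\infty$ and $\sum_e\int_e (q(x)/\omega(e))^2\omega(e)\,dx<\infty$. Under these assumptions every continuous $U:\partial\overline{\mathcal G}\to\mathbb R$ has a unique continuous extension $u:\overline{\mathcal G}\to\mathbb R$ that is $q$-harmonic on $\mathcal G$. Write $L\phi=-\phi''+q\phi$. For continuous $U:\partial\overline{\mathcal G}\to\mathbb R$ with $q$-harmonic extension $u$ and clopen $E\subset\partial\overline{\mathcal G}$, the Dirichlet-Neumann function is $$\Lambda_q(U,E)=\int_{\mathcal G}u\,L\phi,$$ where $\phi\in\mathcal A$ is any function with $\phi=1$ on $E$ and $\phi=0$ on $\partial\overline{\mathcal G}\setminus E$ (such $\phi$ exists and the value does not depend on its choice). $1_\Omega$ is the characteristic function of $\Omega$ on $\partial\overline{\mathcal G}$. *)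

theory Defs
  imports "HOL-Analysis.Analysis"
begin

section \<open>Metric graphs\<close>

text \<open>
  A metric graph has its vertices and the points of its edges in a type \<open>'a\<close>. The edge \<open>e\<close> is
  identified with the interval \<open>{0..elen G e}\<close> by the local coordinate \<open>chart G e\<close>, whose values
  outside that interval are irrelevant.
\<close>

record ('a, 'e) mgraph =
  verts :: "'a set"
  edges :: "'e set"
  elen  :: "'e \<Rightarrow> real"
  chart :: "'e \<Rightarrow> real \<Rightarrow> 'a"

definition ends :: "('a, 'e) mgraph \<Rightarrow> 'e \<Rightarrow> 'a set" where
  "ends G e = {chart G e 0, chart G e (elen G e)}"

definition incident :: "('a, 'e) mgraph \<Rightarrow> 'a \<Rightarrow> 'e set" where
  "incident G v = {e \<in> edges G. v \<in> ends G e}"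

definition degree_of :: "('a, 'e) mgraph \<Rightarrow> 'a \<Rightarrow> nat" where
  "degree_of G v = card (incident G v)"

definition points :: "('a, 'e) mgraph \<Rightarrow> 'a set" where
  "points G = verts G \<union> (\<Union>e\<in>edges G. chart G e ` {0..elen G e})"

text \<open>
  Loops are excluded because a chart is injective on the closed interval; multiple edges are
  excluded because \<open>ends\<close> is injective on the edges. The last condition is local finiteness.
\<close>

definition metric_graph :: "('a, 'e) mgraph \<Rightarrow> bool" where
  "metric_graph G \<longleftrightarrow>
     countable (verts G) \<and>
     (\<forall>e\<in>edges G. 0 < elen G e \<and> inj_on (chart G e) {0..elen G e} \<and>
        ends G e \<subseteq> verts G \<and> chart G e ` {0<..<elen G e} \<inter> verts G = {}) \<and>
     (\<forall>e\<in>edges G. \<forall>e'\<in>edges G. e \<noteq> e' \<longrightarrow>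
        chart G e ` {0<..<elen G e} \<inter> chart G e' ` {0<..<elen G e'} = {}) \<and>
     inj_on (ends G) (edges G) \<and>
     (\<forall>v\<in>verts G. finite (incident G v))"

text \<open>
  \<open>joined G p q r\<close>: some path from \<open>p\<close> to \<open>q\<close>, running successively through finitely many
  segments of edges, has length \<open>r\<close>.
\<close>

inductive joined :: "('a, 'e) mgraph \<Rightarrow> 'a \<Rightarrow> 'a \<Rightarrow> real \<Rightarrow> bool" for G where
  start: "p \<in> points G \<Longrightarrow> joined G p p 0"
| step: "joined G p (chart G e s) r \<Longrightarrow> e \<in> edges G \<Longrightarrow>
     s \<in> {0..elen G e} \<Longrightarrow> t \<in> {0..elen G e} \<Longrightarrow> joined G p (chart G e t) (r + \<bar>t - s\<bar>)"

definition graph_connected :: "('a, 'e) mgraph \<Rightarrow> bool" where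
  "graph_connected G \<longleftrightarrow> (\<forall>p\<in>points G. \<forall>q\<in>points G. \<exists>r. joined G p q r)"

definition gdist :: "('a, 'e) mgraph \<Rightarrow> 'a \<Rightarrow> 'a \<Rightarrow> real" where
  "gdist G p q = Inf {r. joined G p q r}"

text \<open>
  The completion is given up to isometry: the points lie in an ambient metric space whose distance
  restricts to the path distance, and the closure \<open>gbar G\<close> is complete. Thus \<open>gbar G\<close> is a
  complete metric space in which the graph is dense. The infimum in \<open>gdist\<close> is meaningful only for
  a connected graph.
\<close>

definition gbar :: "('a::metric_space, 'e) mgraph \<Rightarrow> 'a set" where
  "gbar G = closure (points G)"

definition has_completion :: "('a::metric_space, 'e) mgraph \<Rightarrow> bool" where
  "has_completion G \<longleftrightarrow>
     (\<forall>p\<in>points G. \<forall>q\<in>points G. dist p q = gdist G p q) \<and> complete (gbar G)"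

definition boundary :: "('a::metric_space, 'e) mgraph \<Rightarrow> 'a set" where
  "boundary G = {v \<in> verts G. degree_of G v = 1} \<union> (gbar G - points G)"

definition weakly_connected :: "('a::metric_space, 'e) mgraph \<Rightarrow> bool" where
  "weakly_connected G \<longleftrightarrow>
     (\<forall>x\<in>gbar G. \<forall>y\<in>gbar G. x \<noteq> y \<longrightarrow>
        (\<exists>W U V. finite W \<and> W \<subseteq> points G \<and>
           openin (top_of_set (gbar G)) U \<and> openin (top_of_set (gbar G)) V \<and> U \<inter> V = {} \<and>
           gbar G - W = U \<union> V \<and> x \<in> U \<and> y \<in> V))"

definition clopen_in_boundary :: "('a::metric_space, 'e) mgraph \<Rightarrow> 'a set \<Rightarrow> bool" where
  "clopen_in_boundary G S \<longleftrightarrow>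
     openin (top_of_set (boundary G)) S \<and> closedin (top_of_set (boundary G)) S"


section \<open>Integration over a metric graph\<close>

text \<open>
  Integrands are given in local coordinates, \<open>f e t\<close> for \<open>t \<in> {0..elen G e}\<close>; the graph carries
  the measure of the disjoint union of its edges. An infinite sum of reals is absolutely convergent.
\<close>

definition edgewise_integrable :: "('a, 'e) mgraph \<Rightarrow> ('e \<Rightarrow> real \<Rightarrow> real) \<Rightarrow> bool" where
  "edgewise_integrable G f \<longleftrightarrow> (\<forall>e\<in>edges G. set_integrable lebesgue {0..elen G e} (f e))"

definition graph_integrable :: "('a, 'e) mgraph \<Rightarrow> ('e \<Rightarrow> real \<Rightarrow> real) \<Rightarrow> bool" where
  "graph_integrable G f \<longleftrightarrow> edgewise_integrable G f \<and>
     (\<lambda>e. LINT t:{0..elen G e}|lebesgue. \<bar>f e t\<bar>) summable_on edges G"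

definition graph_integral :: "('a, 'e) mgraph \<Rightarrow> ('e \<Rightarrow> real \<Rightarrow> real) \<Rightarrow> real" where
  "graph_integral G f = (\<Sum>\<^sub>\<infinity>e\<in>edges G. LINT t:{0..elen G e}|lebesgue. f e t)"

text \<open>
  Edges are compact and the graph is locally finite, so local integrability of the potential is
  integrability on each edge.
\<close>

definition admissible_potential :: "('a, 'e) mgraph \<Rightarrow> ('a \<Rightarrow> real) \<Rightarrow> bool" where
  "admissible_potential G q \<longleftrightarrow>
     (\<forall>x\<in>points G. 0 \<le> q x) \<and>
     edgewise_integrable G (\<lambda>e t. q (chart G e t)) \<and>
     graph_integrable G (\<lambda>e t. q (chart G e t)) \<and>
     (\<exists>\<omega>. (\<forall>e\<in>edges G. 0 < \<omega> e) \<and> \<omega> summable_on edges G \<and>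
        graph_integrable G (\<lambda>e t. (q (chart G e t) / \<omega> e)\<^sup>2 * \<omega> e))"


section \<open>Harmonic functions\<close>

definition abs_continuous_on :: "real \<Rightarrow> real \<Rightarrow> (real \<Rightarrow> real) \<Rightarrow> bool" where
  "abs_continuous_on a b f \<longleftrightarrow>
     (\<forall>\<epsilon>>0. \<exists>\<delta>>0. \<forall>I::(real \<times> real) set.
        finite I \<and> (\<forall>(s, t)\<in>I. a \<le> s \<and> s < t \<and> t \<le> b) \<and>
        pairwise (\<lambda>i j. {fst i<..<snd i} \<inter> {fst j<..<snd j} = {}) I \<and>
        (\<Sum>(s, t)\<in>I. t - s) < \<delta> \<longrightarrow>
        (\<Sum>(s, t)\<in>I. \<bar>f t - f s\<bar>) < \<epsilon>)"

text \<open>The local coordinate of \<open>e\<close> in which the left endpoint \<open>0\<close> corresponds to \<open>v\<close>.\<close>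

definition chart_from :: "('a, 'e) mgraph \<Rightarrow> 'a \<Rightarrow> 'e \<Rightarrow> real \<Rightarrow> 'a" where
  "chart_from G v e t = (if chart G e 0 = v then chart G e t else chart G e (elen G e - t))"

definition normal_deriv :: "('a, 'e) mgraph \<Rightarrow> ('a \<Rightarrow> real) \<Rightarrow> 'a \<Rightarrow> 'e \<Rightarrow> real" where
  "normal_deriv G u v e =
     vector_derivative (\<lambda>t. u (chart_from G v e t)) (at 0 within {0..elen G e})"

text \<open>On an edge, \<open>g\<close> is the derivative of \<open>u\<close>, one-sided at the two ends.\<close>

definition harmonic :: "('a::metric_space, 'e) mgraph \<Rightarrow> ('a \<Rightarrow> real) \<Rightarrow> ('a \<Rightarrow> real) \<Rightarrow> bool" where
  "harmonic G q u \<longleftrightarrow>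
     (\<forall>e\<in>edges G. \<exists>g.
        (\<forall>t\<in>{0..elen G e}.
           ((\<lambda>s. u (chart G e s)) has_real_derivative g t) (at t within {0..elen G e})) \<and>
        abs_continuous_on 0 (elen G e) g \<and>
        (AE t in lebesgue. t \<in> {0<..<elen G e} \<longrightarrow>
           (g has_real_derivative q (chart G e t) * u (chart G e t)) (at t))) \<and>
     (\<forall>v\<in>verts G. 2 \<le> degree_of G v \<longrightarrow>
        continuous (at v within points G) u \<and>
        (\<Sum>e\<in>incident G v. normal_deriv G u v e) = 0)"

definition harmonic_extension ::
  "('a::metric_space, 'e) mgraph \<Rightarrow> ('a \<Rightarrow> real) \<Rightarrow> ('a \<Rightarrow> real) \<Rightarrow> ('a \<Rightarrow> real) \<Rightarrow> bool" where
  "harmonic_extension G q U u \<longleftrightarrow>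
     continuous_on (gbar G) u \<and> harmonic G q u \<and> (\<forall>x\<in>boundary G. u x = U x)"


section \<open>The Dirichlet-Neumann function\<close>

definition test_algebra :: "('a::metric_space, 'e) mgraph \<Rightarrow> ('a \<Rightarrow> real) set" where
  "test_algebra G = {\<phi>.
     continuous_on (gbar G) \<phi> \<and>
     (\<forall>e\<in>edges G. \<forall>t\<in>{0<..<elen G e}. \<forall>n.
        (deriv ^^ n) (\<lambda>s. \<phi> (chart G e s)) differentiable (at t)) \<and>
     (\<exists>F. finite F \<and> F \<subseteq> edges G \<and>
        (\<forall>e\<in>edges G - F. \<forall>t\<in>{0<..<elen G e}. deriv (\<lambda>s. \<phi> (chart G e s)) t = 0)) \<and>
     (\<forall>v\<in>verts G. \<exists>N. open N \<and> v \<in> N \<and>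
        (\<forall>e\<in>edges G. \<forall>t\<in>{0<..<elen G e}.
           chart G e t \<in> N \<longrightarrow> deriv (\<lambda>s. \<phi> (chart G e s)) t = 0))}"

definition schroedinger ::
  "('a, 'e) mgraph \<Rightarrow> ('a \<Rightarrow> real) \<Rightarrow> ('a \<Rightarrow> real) \<Rightarrow> 'e \<Rightarrow> real \<Rightarrow> real" where
  "schroedinger G q \<phi> e t =
     - (deriv ^^ 2) (\<lambda>s. \<phi> (chart G e s)) t + q (chart G e t) * \<phi> (chart G e t)"

text \<open>
  \<open>dn_value G q U S c\<close>: the number \<open>c\<close> is the value of the Dirichlet-Neumann function at
  \<open>(U, S)\<close>, computed from some harmonic extension \<open>u\<close> of \<open>U\<close> and some test function \<open>\<phi>\<close> that is
  \<open>1\<close> on \<open>S\<close> and \<open>0\<close> on the rest of the boundary. It is a relation, so that neither existence of \<open>u\<close> and \<open>\<phi>\<close>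
  nor independence of their choice is built into the definition; a statement about the value is to
  be made for all \<open>c\<close> in the relation.
\<close>

definition dn_value ::
  "('a::metric_space, 'e) mgraph \<Rightarrow> ('a \<Rightarrow> real) \<Rightarrow> ('a \<Rightarrow> real) \<Rightarrow> 'a set \<Rightarrow> real \<Rightarrow> bool" where
  "dn_value G q U S c \<longleftrightarrow>
     (\<exists>u \<phi>. harmonic_extension G q U u \<and>
        \<phi> \<in> test_algebra G \<and> (\<forall>x\<in>S. \<phi> x = 1) \<and> (\<forall>x\<in>boundary G - S. \<phi> x = 0) \<and>
        c = graph_integral G (\<lambda>e t. u (chart G e t) * schroedinger G q \<phi> e t))"

end

theory Submission
  imports Defs
begin

text \<open>
  Integration by parts on each edge turns \<open>\<integral> u L\<phi>\<close> into the flux of \<open>u\<close> weighted by the values of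
  \<open>\<phi>\<close> at the vertices. The vertices accumulate only at points outside the graph, and \<open>\<phi>\<close> takes
  finitely many values on them, so by Kirchhoff's law \<open>\<phi>\<close> may be replaced by the indicator of
  \<open>{v. u v \<in> S \<and> \<phi> v > 1/2}\<close>, where \<open>S\<close> is a neighbourhood of the value of \<open>u\<close> on \<open>E1\<close> or \<open>E2\<close>: the two
  differ at finitely many inner vertices only. For \<open>S = {1 - \<epsilon><..}\<close> convexity of \<open>u\<close> makes the
  contribution of every edge nonnegative. For \<open>S = {..<\<epsilon>}\<close> the contribution of \<open>e\<close> is at most
  \<open>\<epsilon> \<integral>\<^sub>e q\<close>, and it is nonpositive if \<open>q\<close> vanishes where \<open>u < \<epsilon>\<close>. If no edge contributes strictly,
  the indicator is constant by connectedness, which the strong maximum principle excludes.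
\<close>

section \<open>Absolutely continuous functions\<close>

text \<open>The two conditions in the indicator do different work. The one on \<open>\<phi>\<close>
  separates \<open>E\<close> from the rest of the boundary. The one on \<open>u\<close> gives signs:
  off the finite set \<open>F\<close> of edges where \<open>\<phi>\<close> varies, the indicator can
  change along an edge only because \<open>u\<close> leaves \<open>S\<close>, and convexity of
  \<open>u\<close> then controls the derivative at the inner end. On an edge of \<open>F\<close> the
  indicator may change while \<open>u\<close> is in \<open>S\<close> at both ends. The levels are
  therefore chosen beyond all values of \<open>u\<close> at ends of edges of \<open>F\<close> other
  than 1 and 0, so that an end with \<open>u\<close> in \<open>S\<close> is a point where
  \<open>u\<close> attains its maximum or minimum. The two signs are not symmetric because
  \<open>q * u \<ge> 0\<close> helps at high levels and hurts at low ones. Near \<open>E2\<close>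
  the error is a multiple of \<open>\<epsilon>\<close>, so the limit gives only
  \<open>\<le>\<close>. For the strict inequality, compactness turns the neighbourhood of the
  boundary where \<open>q\<close> vanishes into a sublevel set of \<open>u\<close>, as
  \<open>u\<close> is positive off the boundary.\<close>

lemma abs_continuous_onD_tagged:
  assumes ac: "abs_continuous_on a b F" and e: "0 < e"
  obtains d where "0 < d"
    "\<And>p. p tagged_partial_division_of {a..b} \<Longrightarrow> (\<Sum>(x, K)\<in>p. measure lborel K) < d \<Longrightarrow>
       (\<Sum>(x, K)\<in>p. \<bar>F (Sup K) - F (Inf K)\<bar>) < e"
proof -
  from ac e obtain d where d: "0 < d"
    and I: "\<And>I. finite I \<Longrightarrow> (\<forall>(s, t)\<in>I. a \<le> s \<and> s < t \<and> t \<le> b) \<Longrightarrow>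
        pairwise (\<lambda>i j. {fst i<..<snd i} \<inter> {fst j<..<snd j} = {}) I \<Longrightarrow>
        (\<Sum>(s, t)\<in>I. t - s) < d \<Longrightarrow> (\<Sum>(s, t)\<in>I. \<bar>F t - F s\<bar>) < e"
    unfolding abs_continuous_on_def by meson
  have "(\<Sum>(x, K)\<in>p. \<bar>F (Sup K) - F (Inf K)\<bar>) < e"
    if p: "p tagged_partial_division_of {a..b}" and small: "(\<Sum>(x, K)\<in>p. measure lborel K) < d" for p
  proof -
    \<comment> \<open>Degenerate intervals are dropped because absolute continuity is stated for
      \<open>s < t\<close>; the increment of \<open>F\<close> over them is 0.\<close>
    define p' where "p' = {y \<in> p. Inf (snd y) < Sup (snd y)}"
    define h :: "real \<times> real set \<Rightarrow> real \<times> real" where "h y = (Inf (snd y), Sup (snd y))" for y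
    have finp: "finite p" and finp': "finite p'"
      using p unfolding tagged_partial_division_of_def p'_def by auto
    have cb: "\<exists>u v. u \<le> v \<and> K = {u..v} \<and> a \<le> u \<and> v \<le> b" if "(x, K) \<in> p" for x K
    proof -
      have "x \<in> K" "K \<subseteq> {a..b}" "\<exists>u v. K = cbox u v"
        using p that unfolding tagged_partial_division_of_def by blast+
      then obtain u v where "K = {u..v}" "x \<in> {u..v}" "{u..v} \<subseteq> {a..b}" by auto
      then show ?thesis by (intro exI[of _ u] exI[of _ v]) auto
    qed
    have disj: "{fst (h y)<..<snd (h y)} \<inter> {fst (h z)<..<snd (h z)} = {}"
      if yz: "y \<in> p'" "z \<in> p'" "y \<noteq> z" for y z
    proof -
      have *: "interior (snd y) = {fst (h y)<..<snd (h y)}" if "y \<in> p'" for y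
      proof -
        obtain x K where y: "y = (x, K)" by fastforce
        with that cb[of x K] obtain u v where "K = {u..v}" "u \<le> v" by (auto simp: p'_def)
        then show ?thesis by (simp add: y h_def interior_atLeastAtMost_real)
      qed
      have "interior (snd y) \<inter> interior (snd z) = {}"
        using p yz unfolding tagged_partial_division_of_def p'_def by (metis (lifting) mem_Collect_eq prod.collapse)
      with * yz show ?thesis by simp
    qed
    \<comment> \<open>Two members of \<open>p'\<close> with the same interval would have disjoint
      interiors, yet this interior is nonempty.\<close>
    have inj: "inj_on h p'"
    proof (rule inj_onI, rule ccontr)
      fix y z assume yz: "y \<in> p'" "z \<in> p'" "h y = h z" "y \<noteq> z"
      then have "{fst (h y)<..<snd (h y)} = {}" using disj by fastforce
      with yz show False by (auto simp: p'_def h_def)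
    qed
    have pp: "(\<Sum>y\<in>p'. G (Sup (snd y)) - G (Inf (snd y))) = (\<Sum>(s, t)\<in>h ` p'. G t - G s)" for G :: "real \<Rightarrow> real"
      by (subst sum.reindex[OF inj]) (simp add: h_def)
    have pp2: "(\<Sum>y\<in>p'. \<bar>F (Sup (snd y)) - F (Inf (snd y))\<bar>) = (\<Sum>(s, t)\<in>h ` p'. \<bar>F t - F s\<bar>)"
      by (subst sum.reindex[OF inj]) (simp add: h_def)
    have out: "\<bar>F (Sup (snd y)) - F (Inf (snd y))\<bar> = 0" if "y \<in> p - p'" for y
      using that cb[of "fst y" "snd y"] by (auto simp: p'_def)
    have sup_inf: "Sup (snd y) - Inf (snd y) = measure lborel (snd y)" if "y \<in> p" for y
      using that cb[of "fst y" "snd y"] by auto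
    have "(\<Sum>(s, t)\<in>h ` p'. t - s) = (\<Sum>y\<in>p'. measure lborel (snd y))"
      using pp[of "\<lambda>x. x"] sup_inf by (simp add: p'_def)
    also have "\<dots> \<le> (\<Sum>y\<in>p. measure lborel (snd y))"
      by (rule sum_mono2[OF finp]) (auto simp: p'_def)
    also have "\<dots> < d" using small by (simp add: case_prod_unfold)
    finally have *: "(\<Sum>(s, t)\<in>h ` p'. t - s) < d" .
    have "(\<Sum>(s, t)\<in>h ` p'. \<bar>F t - F s\<bar>) < e"
    proof (rule I[OF _ _ _ *])
      show "\<forall>(s, t)\<in>h ` p'. a \<le> s \<and> s < t \<and> t \<le> b"
        using cb by (fastforce simp: h_def p'_def)
      show "pairwise (\<lambda>i j. {fst i<..<snd i} \<inter> {fst j<..<snd j} = {}) (h ` p')"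
        using disj unfolding pairwise_def by blast
    qed (use finp' in auto)
    moreover have "(\<Sum>y\<in>p. \<bar>F (Sup (snd y)) - F (Inf (snd y))\<bar>) = (\<Sum>y\<in>p'. \<bar>F (Sup (snd y)) - F (Inf (snd y))\<bar>)"
      by (rule sum.mono_neutral_right[OF finp]) (use out in \<open>auto simp: p'_def\<close>)
    ultimately show ?thesis using pp2 by (simp add: case_prod_unfold)
  qed
  with d that show thesis by blast
qed

text \<open>A gauge argument. Tags outside \<open>N\<close> are handled by differentiability, as in
  the straddle lemma. Intervals tagged in \<open>N\<close> are confined to an open set of measure
  less than \<open>\<delta>\<close>, where absolute continuity makes the increments of
  \<open>F\<close> small. Integrability of \<open>f\<close> is part of the conclusion.\<close>

lemma fundamental_theorem_of_calculus_abs_continuous: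
  assumes ab: "a \<le> b" and ac: "abs_continuous_on a b F" and N: "negligible N"
    and der: "\<And>t. t \<in> {a..b} - N \<Longrightarrow> (F has_real_derivative f t) (at t within {a..b})"
  shows "(f has_integral F b - F a) {a..b}"
proof -
  \<comment> \<open>With the value 0 on \<open>N\<close>, an interval tagged in \<open>N\<close>
    contributes only its increment of \<open>F\<close> to the error; the spike rule restores
    \<open>f\<close> at the end.\<close>
  define g where "g = (\<lambda>t. if t \<in> N then 0 else f t)"
  have "(g has_integral F b - F a) {a..b}"
    unfolding has_integral_real
  proof safe
    fix e :: real assume "0 < e"
    \<comment> \<open>The summand 1 keeps the denominator positive and
      \<open>c * (b - a) < e / 2\<close> strict even if \<open>a = b\<close>.\<close>
    define c where "c = e / (2 * (b - a + 1))"
    have c: "0 < c" and c2: "c * (b - a) < e / 2"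
      using \<open>0 < e\<close> ab by (auto simp: c_def field_simps)
    obtain \<delta> where \<delta>: "0 < \<delta>"
      "\<And>p. p tagged_partial_division_of {a..b} \<Longrightarrow> (\<Sum>(x, K)\<in>p. measure lborel K) < \<delta> \<Longrightarrow>
       (\<Sum>(x, K)\<in>p. \<bar>F (Sup K) - F (Inf K)\<bar>) < e / 2"
      using abs_continuous_onD_tagged[OF ac, of "e / 2"] \<open>0 < e\<close> by auto
    obtain T where T: "open T" "N \<subseteq> T" "(T - N) \<in> lmeasurable" "emeasure lebesgue (T - N) < ennreal \<delta>"
      using sets_lebesgue_outer_open \<delta>(1) N negligible_imp_sets by metis
    have TN: "T = (T - N) \<union> N" using T by auto
    have Tm: "T \<in> lmeasurable"
      by (subst TN, rule fmeasurable.Un) (use T N negligible_imp_measurable in auto)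
    have Tm2: "measure lebesgue T = measure lebesgue (T - N)"
      by (subst TN, rule measure_Un_null_set) (use T N in \<open>auto simp: negligible_iff_null_sets\<close>)
    have T\<delta>: "measure lebesgue T < \<delta>"
      using T(3,4) \<delta>(1) by (simp add: Tm2 emeasure_eq_measure2 ennreal_less_iff)
    have "\<exists>r>0. (t \<in> N \<longrightarrow> ball t r \<subseteq> T) \<and> (t \<in> {a..b} - N \<longrightarrow>
            (\<forall>s\<in>{a..b}. \<bar>s - t\<bar> < r \<longrightarrow> \<bar>F s - F t - (s - t) * f t\<bar> \<le> c * \<bar>s - t\<bar>))" for t
    proof (cases "t \<in> N")
      case True
      with T show ?thesis by (auto simp: open_contains_ball)
    next
      case False
      show ?thesis
      proof (cases "t \<in> {a..b}")
        case True
        then have "(F has_derivative (*) (f t)) (at t within {a..b})"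
          using der[of t] False by (simp add: has_field_derivative_def)
        then obtain d where "d > 0" "\<forall>s\<in>{a..b}. norm (s - t) < d \<longrightarrow> norm (F s - F t - f t * (s - t)) \<le> c * norm (s - t)"
          unfolding has_derivative_within_alt using c by blast
        then show ?thesis using False by (intro exI[of _ d]) (simp add: mult.commute)
      qed (use False in \<open>auto intro: exI[of _ 1]\<close>)
    qed
    then obtain r where r: "\<And>t. 0 < r t" "\<And>t. t \<in> N \<Longrightarrow> ball t (r t) \<subseteq> T"
      "\<And>t s. t \<in> {a..b} - N \<Longrightarrow> s \<in> {a..b} \<Longrightarrow> \<bar>s - t\<bar> < r t \<Longrightarrow> \<bar>F s - F t - (s - t) * f t\<bar> \<le> c * \<bar>s - t\<bar>"
      by metis
    show "\<exists>\<gamma>. gauge \<gamma> \<and> (\<forall>p. p tagged_division_of {a..b} \<and> \<gamma> fine p \<longrightarrow>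
            norm ((\<Sum>(x, K)\<in>p. measure lborel K *\<^sub>R g x) - (F b - F a)) < e)"
    proof (intro exI conjI allI impI)
      show "gauge (\<lambda>x. ball x (r x))" using r(1) gauge_ball_dependent by blast
      fix p assume "p tagged_division_of {a..b} \<and> (\<lambda>x. ball x (r x)) fine p"
      then have p: "p tagged_division_of {a..b}" and fine: "(\<lambda>x. ball x (r x)) fine p" by auto
      have fp: "finite p" using p by blast
      define pN where "pN = {y \<in> p. fst y \<in> N}"
      have cb: "\<exists>u v. u \<le> v \<and> K = {u..v} \<and> a \<le> u \<and> v \<le> b \<and> x \<in> {u..v} \<and> {u..v} \<subseteq> ball x (r x)" if "(x, K) \<in> p" for x K
      proof -
        have "x \<in> K" "K \<subseteq> {a..b}" "\<exists>u v. K = cbox u v" "K \<subseteq> ball x (r x)"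
          using p that fine unfolding fine_def by blast+
        then obtain u v where "K = {u..v}" "x \<in> {u..v}" "{u..v} \<subseteq> {a..b}" "{u..v} \<subseteq> ball x (r x)" by auto
        then show ?thesis by (intro exI[of _ u] exI[of _ v]) auto
      qed
      have pN: "pN tagged_partial_division_of {a..b}"
        using p tagged_partial_division_subset[of p "{a..b}" pN] unfolding tagged_division_of_def pN_def by auto
      have "(\<Sum>(x, K)\<in>pN. measure lborel K) = (\<Sum>K\<in>snd ` pN. measure lborel K)"
      proof -
        have "pN tagged_division_of (\<Union>(snd ` pN))"
          using tagged_partial_division_of_Union_self[OF pN] .
        from sum.over_tagged_division_lemma[OF this, of "measure lborel"] show ?thesis
          by (simp add: content_eq_0_interior)
      qed
      also have "\<dots> = measure lebesgue (\<Union>(snd ` pN))"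
      proof -
        have "snd ` pN division_of \<Union>(snd ` pN)"
          using partial_division_of_tagged_division[OF pN] .
        from content_division[OF this] show ?thesis
          using cb by (subst sum.cong[OF refl, of _ _ "measure lebesgue"]) (fastforce simp: pN_def)+
      qed
      also have "\<dots> \<le> measure lebesgue T"
      proof (rule measure_mono_fmeasurable)
        show "\<Union>(snd ` pN) \<subseteq> T"
          using cb r(2) unfolding pN_def by fastforce
        show "\<Union>(snd ` pN) \<in> sets lebesgue"
          using lmeasurable_division[OF partial_division_of_tagged_division[OF pN]] by auto
      qed (rule Tm)
      also have "\<dots> < \<delta>" by (rule T\<delta>)
      finally have 1: "(\<Sum>(x, K)\<in>pN. \<bar>F (Sup K) - F (Inf K)\<bar>) < e / 2"
        by (rule \<delta>(2)[OF pN])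
      have good: "\<bar>measure lborel (snd y) * g (fst y) - (F (Sup (snd y)) - F (Inf (snd y)))\<bar> \<le> c * measure lborel (snd y)"
        if y: "y \<in> p - pN" for y
      proof -
        obtain x K where xK: "y = (x, K)" by fastforce
        with y have "(x, K) \<in> p" and xN: "x \<notin> N" by (auto simp: pN_def)
        from cb[OF this(1)] obtain u v where uv: "u \<le> v" "K = {u..v}" "a \<le> u" "v \<le> b" "x \<in> {u..v}"
          and bl: "{u..v} \<subseteq> ball x (r x)" by blast
        have "u \<in> ball x (r x)" "v \<in> ball x (r x)"
          by (rule subsetD[OF bl], use uv in simp)+
        then have "\<bar>F u - F x - (u - x) * f x\<bar> \<le> c * \<bar>u - x\<bar>" "\<bar>F v - F x - (v - x) * f x\<bar> \<le> c * \<bar>v - x\<bar>"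
          using uv xN r(3)[of x u] r(3)[of x v] by (auto simp: dist_real_def)
        moreover have "(v - u) * f x - (F v - F u) = (F u - F x - (u - x) * f x) - (F v - F x - (v - x) * f x)"
          by (simp add: algebra_simps)
        ultimately have "\<bar>(v - u) * f x - (F v - F u)\<bar> \<le> c * \<bar>u - x\<bar> + c * \<bar>v - x\<bar>" by linarith
        \<comment> \<open>The tag lies between \<open>u\<close> and \<open>v\<close>, so the two
          one-sided errors add up to the length of the interval.\<close>
        also have "\<dots> = c * (v - u)" using uv by (simp add: algebra_simps)
        finally show ?thesis using uv xN by (simp add: xK g_def)
      qed
      have bad: "\<bar>measure lborel (snd y) * g (fst y) - (F (Sup (snd y)) - F (Inf (snd y)))\<bar> \<le> \<bar>F (Sup (snd y)) - F (Inf (snd y))\<bar>"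
        if "y \<in> pN" for y using that by (simp add: pN_def g_def)
      have "(\<Sum>(x, K)\<in>p. measure lborel K *\<^sub>R g x) - (F b - F a)
            = (\<Sum>y\<in>p. measure lborel (snd y) * g (fst y) - (F (Sup (snd y)) - F (Inf (snd y))))"
        using additive_tagged_division_1[OF ab p, of F] by (simp add: case_prod_unfold sum_subtractf)
      also have "\<bar>\<dots>\<bar> \<le> (\<Sum>y\<in>p. \<bar>measure lborel (snd y) * g (fst y) - (F (Sup (snd y)) - F (Inf (snd y)))\<bar>)"
        by (rule sum_abs)
      also have "\<dots> = (\<Sum>y\<in>p - pN. \<bar>measure lborel (snd y) * g (fst y) - (F (Sup (snd y)) - F (Inf (snd y)))\<bar>)
          + (\<Sum>y\<in>pN. \<bar>measure lborel (snd y) * g (fst y) - (F (Sup (snd y)) - F (Inf (snd y)))\<bar>)"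
        by (rule sum.subset_diff) (auto simp: pN_def fp)
      also have "\<dots> \<le> (\<Sum>y\<in>p - pN. c * measure lborel (snd y)) + (\<Sum>y\<in>pN. \<bar>F (Sup (snd y)) - F (Inf (snd y))\<bar>)"
        by (intro add_mono sum_mono good bad)
      also have "(\<Sum>y\<in>p - pN. c * measure lborel (snd y)) \<le> (\<Sum>y\<in>p. c * measure lborel (snd y))"
        using c fp by (intro sum_mono2) auto
      also have "(\<Sum>y\<in>p. c * measure lborel (snd y)) = c * (b - a)"
        using additive_content_tagged_division[of p a b] p ab
        by (simp add: case_prod_unfold sum_distrib_left[symmetric])
      finally show "norm ((\<Sum>(x, K)\<in>p. measure lborel K *\<^sub>R g x) - (F b - F a)) < e"
        using c2 1 by (simp add: case_prod_unfold)
    qed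
  qed
  then show ?thesis
    by (rule has_integral_spike[OF N, rotated]) (auto simp: g_def)
qed

text \<open>Serves for products in which \<open>f\<close> is the only factor that is not Lipschitz:
  the increments of the product are then controlled by those of \<open>f\<close> and by the
  length.\<close>

lemma abs_continuous_on_dominated:
  assumes ac: "abs_continuous_on a b f" and C: "0 < C"
    and bd: "\<And>s t. a \<le> s \<Longrightarrow> s < t \<Longrightarrow> t \<le> b \<Longrightarrow> \<bar>F t - F s\<bar> \<le> C * (\<bar>f t - f s\<bar> + (t - s))"
  shows "abs_continuous_on a b F"
  unfolding abs_continuous_on_def
proof (intro strip)
  fix e :: real assume e: "0 < e"
  then have "0 < e / (2 * C)" using C by simp
  from ac[unfolded abs_continuous_on_def, THEN spec, THEN mp, OF this] obtain d where d: "0 < d"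
    and I: "\<And>I. finite I \<and> (\<forall>(s, t)\<in>I. a \<le> s \<and> s < t \<and> t \<le> b) \<and>
        pairwise (\<lambda>i j. {fst i<..<snd i} \<inter> {fst j<..<snd j} = {}) I \<and>
        (\<Sum>(s, t)\<in>I. t - s) < d \<longrightarrow> (\<Sum>(s, t)\<in>I. \<bar>f t - f s\<bar>) < e / (2 * C)"
    by (elim exE conjE) (rule that, assumption, erule spec)
  show "\<exists>d>0. \<forall>I. finite I \<and> (\<forall>(s, t)\<in>I. a \<le> s \<and> s < t \<and> t \<le> b) \<and>
        pairwise (\<lambda>i j. {fst i<..<snd i} \<inter> {fst j<..<snd j} = {}) I \<and>
        (\<Sum>(s, t)\<in>I. t - s) < d \<longrightarrow> (\<Sum>(s, t)\<in>I. \<bar>F t - F s\<bar>) < e"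
  proof (intro exI conjI strip)
    show "0 < min d (e / (2 * C))" using d C e by simp
    fix J :: "(real \<times> real) set"
    assume J: "finite J \<and> (\<forall>(s, t)\<in>J. a \<le> s \<and> s < t \<and> t \<le> b) \<and>
        pairwise (\<lambda>i j. {fst i<..<snd i} \<inter> {fst j<..<snd j} = {}) J \<and>
        (\<Sum>(s, t)\<in>J. t - s) < min d (e / (2 * C))"
    have "(\<Sum>(s, t)\<in>J. \<bar>F t - F s\<bar>) \<le> (\<Sum>(s, t)\<in>J. C * (\<bar>f t - f s\<bar> + (t - s)))"
      using J bd by (intro sum_mono) (auto simp: case_prod_unfold)
    also have "\<dots> = C * ((\<Sum>(s, t)\<in>J. \<bar>f t - f s\<bar>) + (\<Sum>(s, t)\<in>J. t - s))"
      by (simp add: case_prod_unfold sum_distrib_left[symmetric] sum.distrib)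
    also have "\<dots> < C * (e / (2 * C) + e / (2 * C))"
      using I[of J] J C by (intro mult_strict_left_mono add_strict_mono) auto
    also have "\<dots> = e" using C by simp
    finally show "(\<Sum>(s, t)\<in>J. \<bar>F t - F s\<bar>) < e" .
  qed
qed

section \<open>The equation on an interval\<close>

text \<open>
  The equation \<open>U'' = Q U\<close> on \<open>{0..L}\<close> with \<open>g = U'\<close>, where the second derivative is
  encoded by the increments of \<open>g\<close>.
\<close>

definition solution_on :: "real \<Rightarrow> (real \<Rightarrow> real) \<Rightarrow> (real \<Rightarrow> real) \<Rightarrow> (real \<Rightarrow> real) \<Rightarrow> bool" where
  "solution_on L Q U g \<longleftrightarrow> 0 < L \<and> (\<forall>t\<in>{0..L}. 0 \<le> Q t) \<and> Q integrable_on {0..L} \<and>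
     (\<forall>t\<in>{0..L}. (U has_real_derivative g t) (at t within {0..L})) \<and>
     (\<forall>a b. 0 \<le> a \<and> a \<le> b \<and> b \<le> L \<longrightarrow> ((\<lambda>t. Q t * U t) has_integral (g b - g a)) {a..b})"

lemma has_integral_reflect_Icc:
  fixes f :: "real \<Rightarrow> real"
  assumes "(f has_integral i) {L - b..L - a}"
  shows "((\<lambda>t. f (L - t)) has_integral i) {a..b}"
proof -
  have im: "(\<lambda>x. L - x) ` {L - b..L - a} = {a..b}" by (force simp: image_iff)
  have "((\<lambda>x. f (- x + L)) has_integral i) ((\<lambda>x. - x + L) ` {L - b..L - a})"
    using assms has_integral_affinity[of f i "L - b" "L - a" "-1" L] by (simp add: image_image)
  then show ?thesis by (simp add: im add.commute[of _ L])
qed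

text \<open>Reversing the coordinate keeps the equation and changes the sign of the derivative, so
  statements about one end or one direction serve for the other as well.\<close>

lemma solution_reflect:
  assumes "solution_on L Q U g"
  shows "solution_on L (\<lambda>t. Q (L - t)) (\<lambda>t. U (L - t)) (\<lambda>t. - g (L - t))"
proof -
  have im: "(\<lambda>x. L - x) ` {a..b} = {L - b..L - a}" for a b by (force simp: image_iff)
  note refl = has_integral_reflect_Icc
  have "((\<lambda>t. Q (L - t) * U (L - t)) has_integral - g (L - b) - - g (L - a)) {a..b}"
    if "0 \<le> a" "a \<le> b" "b \<le> L" for a b
  proof -
    have "((\<lambda>t. Q t * U t) has_integral g (L - a) - g (L - b)) {L - b..L - a}"
      using assms that unfolding solution_on_def by auto
    from refl[OF this] show ?thesis by (simp add: algebra_simps)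
  qed
  moreover have "(\<lambda>t. Q (L - t)) integrable_on {0..L}"
    using assms refl[of Q _ L L 0] by (auto simp: solution_on_def integrable_on_def)
  moreover have "((\<lambda>t. U (L - t)) has_real_derivative - g (L - t)) (at t within {0..L})" if "t \<in> {0..L}" for t
  proof -
    have "(U has_real_derivative g (L - t)) (at (L - t) within (\<lambda>x. L - x) ` {0..L})"
      using assms that by (simp add: solution_on_def im)
    moreover have "((\<lambda>x. L - x) has_real_derivative - 1) (at t within {0..L})"
      by (auto intro!: derivative_eq_intros)
    ultimately have "(U \<circ> (\<lambda>x. L - x) has_real_derivative g (L - t) * - 1) (at t within {0..L})"
      by (rule DERIV_image_chain)
    then show ?thesis by (simp add: o_def)
  qed
  ultimately show ?thesis using assms by (simp add: solution_on_def)
qed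

context
  fixes L Q U g assumes sol: "solution_on L Q U g"
begin

lemma solution_length_pos: "0 < L"
  using sol by (simp add: solution_on_def)

lemma solution_deriv: "t \<in> {0..L} \<Longrightarrow> (U has_real_derivative g t) (at t within {0..L})"
  using sol by (simp add: solution_on_def)

lemma solution_deriv_interior: "0 < t \<Longrightarrow> t < L \<Longrightarrow> (U has_real_derivative g t) (at t)"
  using solution_deriv[of t] by (simp add: at_within_Icc_at)

lemma solution_continuous: "continuous_on {0..L} U"
  using solution_deriv by (meson DERIV_continuous continuous_on_eq_continuous_within)

lemma solution_deriv_increment:
  "0 \<le> a \<Longrightarrow> a \<le> b \<Longrightarrow> b \<le> L \<Longrightarrow> ((\<lambda>t. Q t * U t) has_integral (g b - g a)) {a..b}"
  using sol by (simp add: solution_on_def)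

lemma solution_potential_nonneg: "t \<in> {0..L} \<Longrightarrow> 0 \<le> Q t"
  using sol by (simp add: solution_on_def)

lemma solution_potential_integrable: "0 \<le> a \<Longrightarrow> b \<le> L \<Longrightarrow> Q integrable_on {a..b}"
  using sol by (auto simp: solution_on_def intro: integrable_subinterval_real)

lemma solution_mean_value:
  assumes "0 \<le> a" "a < b" "b \<le> L"
  obtains t where "a < t" "t < b" "U b - U a = (b - a) * g t"
proof -
  have "(U has_derivative (*) (g x)) (at x within {a..b})" if "a \<le> x" "x \<le> b" for x
    using solution_deriv[of x] assms that unfolding has_field_derivative_def
    by (auto intro: has_derivative_subset)
  from mvt_simple[OF assms(2) this] obtain t where "t \<in> {a<..<b}" "U b - U a = g t * (b - a)" by blast
  with that show thesis by (auto simp: mult.commute)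
qed

lemma solution_deriv_const:
  assumes "0 \<le> a" "a \<le> b" "b \<le> L" "\<And>t. a < t \<Longrightarrow> t < b \<Longrightarrow> Q t * U t = 0"
  shows "g b = g a"
proof -
  have "((\<lambda>t. 0) has_integral (g b - g a)) {a..b}"
    by (rule has_integral_spike[OF _ _ solution_deriv_increment[OF assms(1-3)], of "{a, b}"]) (use assms(4) in force)+
  then show ?thesis by (metis eq_iff_diff_eq_0 has_integral_is_0 has_integral_unique)
qed

lemma solution_left_min:
  assumes "\<And>t. t \<in> {0..L} \<Longrightarrow> U 0 \<le> U t"
  shows "0 \<le> g 0"
proof (rule ccontr)
  assume "\<not> 0 \<le> g 0"
  then obtain d where d: "0 < d" "\<And>h. 0 < h \<Longrightarrow> 0 + h \<in> {0..L} \<Longrightarrow> h < d \<Longrightarrow> U (0 + h) < U 0"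
    using has_real_derivative_neg_dec_right[OF solution_deriv, of 0] solution_length_pos by force
  have "U (0 + min (d/2) L) < U 0" using d(1) solution_length_pos by (intro d(2)) auto
  with assms[of "min (d/2) L"] d(1) solution_length_pos show False by simp
qed

lemma solution_interior_extremum:
  assumes "0 < s" "s < L" "(\<forall>t\<in>{0..L}. U s \<le> U t) \<or> (\<forall>t\<in>{0..L}. U t \<le> U s)"
  shows "g s = 0"
proof -
  have *: "\<forall>y. \<bar>s - y\<bar> < min s (L - s) \<longrightarrow> y \<in> {0..L}" by auto
  show ?thesis
    using assms(3)
  proof
    assume "\<forall>t\<in>{0..L}. U s \<le> U t"
    then show ?thesis
      using DERIV_local_min[OF solution_deriv_interior[OF assms(1,2)], of "min s (L - s)"] assms * by auto
  next
    assume "\<forall>t\<in>{0..L}. U t \<le> U s"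
    then show ?thesis
      using DERIV_local_max[OF solution_deriv_interior[OF assms(1,2)], of "min s (L - s)"] assms * by auto
  qed
qed

text \<open>
  With \<open>V = U - m\<close> and \<open>m \<le> 0\<close> one has \<open>V'' \<le> Q V\<close> and \<open>V s = V' s = 0\<close>. On an interval of length
  \<open>d\<close> with \<open>d * (\<integral>Q) < 1\<close>, integrating twice bounds the maximum of \<open>V\<close> by a smaller multiple of itself.
\<close>

lemma solution_min_step:
  assumes "m \<le> 0" and min: "\<And>t. t \<in> {0..L} \<Longrightarrow> m \<le> U t"
    and s: "s \<in> {0..L}" "U s = m" "g s = 0"
    and b: "s \<le> b" "b \<le> L" "(b - s) * integral {0..L} Q < 1"
  shows "U b = m \<and> g b = 0"
proof -
  have sub: "{s..b} \<subseteq> {0..L}" using s b by auto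
  obtain x where x: "x \<in> {s..b}" and sup: "\<And>t. t \<in> {s..b} \<Longrightarrow> U t \<le> U x"
    using continuous_attains_sup[of "{s..b}" U] continuous_on_subset[OF solution_continuous sub] b by auto
  have Qs: "Q integrable_on {s..t}" "integral {s..t} Q \<le> integral {0..L} Q" if "t \<in> {s..b}" for t
  proof -
    show "Q integrable_on {s..t}" using that s b by (intro solution_potential_integrable) auto
    then show "integral {s..t} Q \<le> integral {0..L} Q"
      using that s b by (intro integral_subset_le solution_potential_integrable) (auto intro: solution_potential_nonneg)
  qed
  have g: "g t \<le> integral {0..L} Q * (U x - m)" if t: "t \<in> {s..b}" for t
  proof -
    have "g t - g s \<le> integral {s..t} Q * (U x - m)"
    proof (rule has_integral_le)
      show "((\<lambda>t. Q t * U t) has_integral g t - g s) {s..t}" using t s b by (intro solution_deriv_increment) auto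
      show "((\<lambda>t. Q t * (U x - m)) has_integral integral {s..t} Q * (U x - m)) {s..t}"
        using Qs(1)[OF t] by (intro has_integral_mult_left integrable_integral)
      fix y assume y: "y \<in> {s..t}"
      \<comment> \<open>Here the sign of \<open>m\<close> enters:
        \<open>U y \<le> U x \<le> U x - m\<close>.\<close>
      then have "U y \<le> U x - m" using sup[of y] \<open>m \<le> 0\<close> t by auto
      then show "Q y * U y \<le> Q y * (U x - m)"
        using y t s b by (intro mult_left_mono solution_potential_nonneg) auto
    qed
    also have "\<dots> \<le> integral {0..L} Q * (U x - m)"
      using Qs(2)[OF t] min[of x] x sub by (intro mult_right_mono) auto
    finally show ?thesis using s by simp
  qed
  have Ux: "U x = m"
  proof (rule ccontr)
    assume ne: "U x \<noteq> m"
    with min[of x] x sub have pos: "0 < U x - m" by force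
    from ne s x have "s < x" by (cases "s = x") auto
    then obtain t where t: "s < t" "t < x" "U x - U s = (x - s) * g t"
      using solution_mean_value[of s x] s x b by auto
    have "U x - m \<le> (x - s) * (integral {0..L} Q * (U x - m))"
      using t s x g[of t] by (auto intro!: mult_left_mono)
    also have "\<dots> \<le> (b - s) * (integral {0..L} Q * (U x - m))"
      using x pos solution_potential_nonneg by (intro mult_right_mono mult_nonneg_nonneg integral_nonneg)
        (auto simp: solution_potential_integrable)
    also have "\<dots> < 1 * (U x - m)"
      using mult_strict_right_mono[OF b(3) pos] by (simp add: mult.assoc)
    finally show False by simp
  qed
  have const: "U t = m" if "t \<in> {s..b}" for t
    using sup[OF that] min[of t] that sub Ux by force
  \<comment> \<open>\<open>U\<close> is constant on \<open>{s..b}\<close>, so its one-sided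
    derivative at \<open>b\<close> vanishes; this restores the hypothesis for the next step of the
    iteration.\<close>
  have "g b = 0"
  proof (cases "s = b")
    case False
    then have "s < b" using b by simp
    have "((\<lambda>t. m) has_real_derivative g b) (at b within {s..b})"
    proof (rule has_field_derivative_transform_within[where d = 1])
      show "(U has_real_derivative g b) (at b within {s..b})"
        using solution_deriv[of b] s b sub by (auto intro: DERIV_subset)
    qed (use const b in auto)
    moreover have "((\<lambda>t. m) has_real_derivative 0) (at b within {s..b})" by simp
    moreover have "at b within {s..b} \<noteq> bot"
      using \<open>s < b\<close> by (simp add: at_within_Icc_at_left)
    ultimately show ?thesis by (rule has_field_derivative_unique)
  qed (use s in auto)
  with const[of b] b show ?thesis by simp
qed

text \<open>The short interval of the preceding lemma is moved to the right until it has passed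
  \<open>t\<close>, carrying along both \<open>U = m\<close> and \<open>g = 0\<close>.\<close>

lemma solution_min_right:
  assumes "m \<le> 0" and min: "\<And>t. t \<in> {0..L} \<Longrightarrow> m \<le> U t"
    and s: "s \<in> {0..L}" "U s = m" "g s = 0" and t: "t \<in> {s..L}"
  shows "U t = m"
proof -
  define Z where "Z = integral {0..L} Q"
  have "0 \<le> Z" unfolding Z_def by (intro integral_nonneg) (auto simp: solution_potential_integrable solution_potential_nonneg)
  \<comment> \<open>The step length depends on the total integral of \<open>Q\<close> only, and
    \<open>d * Z < 1\<close> holds also for \<open>Z = 0\<close>.\<close>
  define d where "d = 1 / (Z + 1)"
  have d: "0 < d" "d * Z < 1" using \<open>0 \<le> Z\<close> by (auto simp: d_def field_simps)
  have "U (min t (s + of_nat n * d)) = m \<and> g (min t (s + of_nat n * d)) = 0" for n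
  proof (induction n)
    case 0
    then show ?case using s t by simp
  next
    case (Suc n)
    let ?a = "min t (s + of_nat n * d)" and ?b = "min t (s + of_nat (Suc n) * d)"
    have nd: "0 \<le> real n * d" using d by simp
    have ab: "?a \<le> ?b" "?b - ?a \<le> d" using d by (auto simp: algebra_simps min_def)
    have "(?b - ?a) * Z \<le> d * Z" using ab \<open>0 \<le> Z\<close> by (intro mult_right_mono) auto
    also have "\<dots> < 1" by (rule d)
    finally have small: "(?b - ?a) * integral {0..L} Q < 1" by (simp add: Z_def)
    have "?a \<in> {0..L}" "?b \<le> L" using s t nd by auto
    with solution_min_step[OF assms(1) min _ _ _ ab(1) _ small] Suc.IH show ?case by blast
  qed
  note iter = this
  obtain n where "t - s < of_nat n * d" using reals_Archimedean3[OF d(1)] by blast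
  then have "min t (s + of_nat n * d) = t" by simp
  with iter[of n] show ?thesis by simp
qed

section \<open>Nonnegative solutions, which are convex\<close>

context
  assumes nonneg: "\<And>t. t \<in> {0..L} \<Longrightarrow> 0 \<le> U t"
begin

lemma solution_deriv_mono: "0 \<le> a \<Longrightarrow> a \<le> b \<Longrightarrow> b \<le> L \<Longrightarrow> g a \<le> g b"
  using has_integral_nonneg[OF solution_deriv_increment[of a b]] nonneg solution_potential_nonneg by force

lemma solution_above_left_tangent:
  assumes "0 \<le> a" "a \<le> b" "b \<le> L"
  shows "U a + g a * (b - a) \<le> U b"
proof (cases "a = b")
  case False
  then obtain t where t: "a < t" "t < b" "U b - U a = (b - a) * g t"
    using solution_mean_value[of a b] assms by auto
  have "g a * (b - a) \<le> g t * (b - a)" using t assms by (intro mult_right_mono solution_deriv_mono) auto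
  with t(3) show ?thesis by (simp add: mult.commute[of "b - a"])
qed simp

lemma solution_below_right_tangent:
  assumes "0 \<le> a" "a \<le> b" "b \<le> L"
  shows "U b \<le> U a + g b * (b - a)"
proof (cases "a = b")
  case False
  then obtain t where t: "a < t" "t < b" "U b - U a = (b - a) * g t"
    using solution_mean_value[of a b] assms by auto
  have "g t * (b - a) \<le> g b * (b - a)" using t assms by (intro mult_right_mono solution_deriv_mono) auto
  with t(3) show ?thesis by (simp add: mult.commute[of "b - a"])
qed simp

lemma solution_le_max:
  assumes "0 \<le> a" "a \<le> t" "t \<le> b" "b \<le> L"
  shows "U t \<le> max (U a) (U b)"
proof (cases "0 \<le> g t")
  case True
  then have "U t \<le> U t + g t * (b - t)" using assms by simp
  also have "\<dots> \<le> U b" using assms by (intro solution_above_left_tangent) auto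
  finally show ?thesis by simp
next
  case False
  then have "g t * (t - a) \<le> 0" using assms by (intro mult_nonpos_nonneg) auto
  with solution_below_right_tangent[of a t] assms show ?thesis by simp
qed

lemma solution_max_unique:
  assumes "\<And>t. t \<in> {0..L} \<Longrightarrow> U t \<le> U s" and "s \<in> {0..L}" "g s = 0" "t \<in> {0..L}"
  shows "U t = U s"
proof (cases "s \<le> t")
  case True
  with solution_above_left_tangent[of s t] assms show ?thesis by (simp add: antisym)
next
  case False
  with solution_below_right_tangent[of t s] assms show ?thesis by (simp add: antisym)
qed

lemma solution_left_max:
  assumes "U L \<le> U 0"
  shows "g 0 \<le> 0"
proof -
  have "g 0 * L \<le> 0" using solution_above_left_tangent[of 0 L] solution_length_pos assms by simp
  then show ?thesis using solution_length_pos by (simp add: mult_le_0_iff)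
qed

lemma solution_left_strict_max:
  assumes "U L < U 0"
  shows "g 0 < 0"
proof -
  have "g 0 * L < 0" using solution_above_left_tangent[of 0 L] solution_length_pos assms by simp
  then show ?thesis using solution_length_pos by (simp add: mult_less_0_iff)
qed

text \<open>Integrate from \<open>0\<close> to a minimum point of \<open>U\<close>, where \<open>g\<close> vanishes; up to there \<open>U \<le> U 0\<close>.\<close>

lemma solution_outflow_bound:
  assumes "U 0 < U L"
  shows "- g 0 \<le> U 0 * integral {0..L} Q"
proof (cases "0 \<le> g 0")
  case True
  have "0 \<le> U 0 * integral {0..L} Q"
    by (intro mult_nonneg_nonneg integral_nonneg)
      (use nonneg[of 0] solution_length_pos in \<open>auto simp: solution_potential_integrable solution_potential_nonneg\<close>)
  with True show ?thesis by simp
next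
  case False
  obtain s where s: "s \<in> {0..L}" and min: "\<And>t. t \<in> {0..L} \<Longrightarrow> U s \<le> U t"
    using continuous_attains_inf[OF _ _ solution_continuous] solution_length_pos by fastforce
  have "s \<noteq> 0" using solution_left_min min False by auto
  moreover have "s \<noteq> L" using min[of 0] assms solution_length_pos by auto
  ultimately have "g s = 0" using s min by (intro solution_interior_extremum) auto
  moreover have "g s - g 0 \<le> U 0 * integral {0..s} Q"
  proof (rule has_integral_le)
    show "((\<lambda>t. Q t * U t) has_integral g s - g 0) {0..s}" using s by (intro solution_deriv_increment) auto
    show "((\<lambda>t. U 0 * Q t) has_integral U 0 * integral {0..s} Q) {0..s}"
      using s by (intro has_integral_mult_right integrable_integral solution_potential_integrable) auto
    fix t assume t: "t \<in> {0..s}"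
    then have "U t \<le> U 0" using solution_le_max[of 0 t s] s min[of 0] by auto
    then show "Q t * U t \<le> U 0 * Q t"
      using t s solution_potential_nonneg[of t] by (simp add: mult.commute mult_left_mono)
  qed
  moreover have "U 0 * integral {0..s} Q \<le> U 0 * integral {0..L} Q"
    using s nonneg[of 0] solution_length_pos
    by (intro mult_left_mono integral_subset_le) (auto simp: solution_potential_integrable solution_potential_nonneg)
  ultimately show ?thesis by simp
qed

text \<open>As long as \<open>U < \<epsilon>\<close> the potential vanishes, so \<open>U\<close>
  continues along a line of slope \<open>g s \<le> 0\<close>. The first point at the level
  \<open>\<epsilon>\<close> would contradict this.\<close>

lemma solution_decreasing_free:
  assumes free: "\<And>t. t \<in> {0..L} \<Longrightarrow> U t < \<epsilon> \<Longrightarrow> Q t = 0"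
    and s: "s \<in> {0..L}" "U s < \<epsilon>" "g s \<le> 0" and t: "t \<in> {s..L}"
  shows "U t < \<epsilon>"
proof (rule ccontr)
  assume "\<not> U t < \<epsilon>"
  define T where "T = {x \<in> {s..t}. \<epsilon> \<le> U x}"
  have cont: "continuous_on {s..t} U" using s t by (intro continuous_on_subset[OF solution_continuous]) auto
  have "compact T"
  proof -
    have "closed T"
    proof -
      have "T = {s..t} \<inter> U -` {\<epsilon>..}" by (auto simp: T_def)
      then show ?thesis using continuous_closed_preimage[OF cont] by simp
    qed
    moreover have "bounded T" by (rule bounded_subset[of "{s..t}"]) (auto simp: T_def)
    ultimately show ?thesis by (simp add: compact_eq_bounded_closed)
  qed
  moreover have "T \<noteq> {}" using \<open>\<not> U t < \<epsilon>\<close> t by (auto simp: T_def)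
  ultimately obtain x where x: "x \<in> T" and least: "\<And>y. y \<in> T \<Longrightarrow> x \<le> y"
    using compact_attains_inf by metis
  have below: "U y < \<epsilon>" if "s \<le> y" "y < x" for y
    using that x least[of y] by (force simp: T_def)
  have "g x = g s"
    using x t s below free by (intro solution_deriv_const) (auto simp: T_def)
  then have "U x \<le> U s + g s * (x - s)" using solution_below_right_tangent[of s x] x t s by (auto simp: T_def)
  moreover have "g s * (x - s) \<le> 0" using x s by (intro mult_nonpos_nonneg) (auto simp: T_def)
  ultimately show False using x s by (simp add: T_def)
qed

end

end

lemma solution_min_unique:
  assumes sol: "solution_on L Q U g" and "m \<le> 0" and min: "\<And>t. t \<in> {0..L} \<Longrightarrow> m \<le> U t"
    and s: "s \<in> {0..L}" "U s = m" "g s = 0" and t: "t \<in> {0..L}"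
  shows "U t = m"
proof (cases "s \<le> t")
  case True
  then show ?thesis using solution_min_right[OF sol assms(2) min s] t by auto
next
  case False
  have "U (L - (L - t)) = m"
    by (rule solution_min_right[OF solution_reflect[OF sol] assms(2), of "L - s"]) (use False min s t in auto)
  then show ?thesis by simp
qed

section \<open>Integration by parts on an edge\<close>

lemma abs_continuous_on_imp_continuous_on:
  assumes "abs_continuous_on a b f"
  shows "continuous_on {a..b} f"
proof (unfold continuous_on_iff, intro ballI allI impI)
  fix x e :: real assume x: "x \<in> {a..b}" and e: "0 < e"
  from assms[unfolded abs_continuous_on_def, THEN spec, THEN mp, OF e]
  obtain d where d: "0 < d" and I: "\<forall>I. finite I \<and> (\<forall>(s, t)\<in>I. a \<le> s \<and> s < t \<and> t \<le> b) \<and>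
        pairwise (\<lambda>i j. {fst i<..<snd i} \<inter> {fst j<..<snd j} = {}) I \<and>
        (\<Sum>(s, t)\<in>I. t - s) < d \<longrightarrow> (\<Sum>(s, t)\<in>I. \<bar>f t - f s\<bar>) < e"
    by (elim exE conjE) (rule that)
  have *: "\<bar>f t - f s\<bar> < e" if "a \<le> s" "s < t" "t \<le> b" "t - s < d" for s t
    using I[THEN spec, of "{(s, t)}"] that by simp
  have "dist (f y) (f x) < e" if "y \<in> {a..b}" "dist y x < d" for y
    using *[of x y] *[of y x] that x e by (cases x y rule: linorder_cases) (auto simp: dist_real_def)
  with d show "\<exists>d>0. \<forall>y\<in>{a..b}. dist y x < d \<longrightarrow> dist (f y) (f x) < e" by blast
qed

text \<open>One constant for both the size and the Lipschitz estimate keeps the product estimate in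
  the integration by parts short.\<close>

lemma lipschitz_bound_of_derivative:
  fixes f :: "real \<Rightarrow> real"
  assumes "continuous_on {a..b} f" "continuous_on {a..b} f'"
    and "\<And>t. a < t \<Longrightarrow> t < b \<Longrightarrow> (f has_real_derivative f' t) (at t)"
  obtains B where "0 < B" "\<And>t. t \<in> {a..b} \<Longrightarrow> \<bar>f t\<bar> \<le> B"
    "\<And>s t. a \<le> s \<Longrightarrow> s < t \<Longrightarrow> t \<le> b \<Longrightarrow> \<bar>f t - f s\<bar> \<le> B * (t - s)"
proof -
  have bd: "\<exists>B>0. \<forall>t\<in>{a..b}. \<bar>h t\<bar> \<le> B" if "continuous_on {a..b} h" for h :: "real \<Rightarrow> real"
    using compact_imp_bounded[OF compact_continuous_image[OF that compact_Icc]]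
    by (auto simp: bounded_pos)
  from bd[OF assms(1)] bd[OF assms(2)] obtain B C where B: "B > 0" "\<And>t. t \<in> {a..b} \<Longrightarrow> \<bar>f t\<bar> \<le> B"
    and C: "C > 0" "\<And>t. t \<in> {a..b} \<Longrightarrow> \<bar>f' t\<bar> \<le> C" by blast
  have "\<bar>f t - f s\<bar> \<le> (B + C) * (t - s)" if st: "a \<le> s" "s < t" "t \<le> b" for s t
  proof -
    have der: "(f has_derivative (*) (f' x)) (at x)" if "s < x" "x < t" for x
      using assms(3)[of x] that st by (simp add: has_field_derivative_def)
    have cont: "continuous_on {s..t} f" using st by (intro continuous_on_subset[OF assms(1)]) auto
    obtain x where x: "s < x" "x < t" "f t - f s = f' x * (t - s)"
      using mvt[OF st(2) cont der] by blast
    have "\<bar>f' x\<bar> * (t - s) \<le> (B + C) * (t - s)"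
      using C(2)[of x] B(1) x st by (intro mult_right_mono) auto
    with x st show ?thesis by (simp add: abs_mult)
  qed
  moreover have "\<bar>f t\<bar> \<le> B + C" if "t \<in> {a..b}" for t using B(2)[OF that] C(1) by simp
  ultimately show thesis using that[of "B + C"] B(1) C(1) by simp
qed

text \<open>
  \<open>P\<close> is locally constant near both ends of the interval, so its derivatives extend
  continuously by \<open>0\<close>; the values of \<open>(deriv ^^ 2) P\<close> at the ends are junk.
\<close>

lemma integral_by_parts_test_function:
  assumes sol: "solution_on L Q U g" and ac: "abs_continuous_on 0 L g"
    and ae: "AE t in lebesgue. t \<in> {0<..<L} \<longrightarrow> (g has_real_derivative Q t * U t) (at t)"
    and Q: "set_integrable lebesgue {0..L} Q"
    and P: "continuous_on {0..L} P"
    and smooth: "\<And>t n. 0 < t \<Longrightarrow> t < L \<Longrightarrow> (deriv ^^ n) P differentiable (at t)"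
    and \<delta>: "0 < \<delta>" "\<And>t. 0 < t \<Longrightarrow> t < L \<Longrightarrow> t < \<delta> \<or> L - \<delta> < t \<Longrightarrow> deriv P t = 0"
  shows "(LINT t:{0..L}|lebesgue. U t * (- (deriv ^^ 2) P t + Q t * P t)) = g L * P L - g 0 * P 0"
proof -
  have L: "0 < L" using sol by (rule solution_length_pos)
  define d where "d t = (if 0 < t \<and> t < L then deriv P t else 0)" for t
  define d2 where "d2 t = (if 0 < t \<and> t < L then (deriv ^^ 2) P t else 0)" for t
  have derP: "(P has_real_derivative d t) (at t)" if "0 < t" "t < L" for t
    using smooth[OF that, of 0] that by (simp add: d_def real_differentiable_def) (metis DERIV_imp_deriv)
  have derd: "(d has_real_derivative d2 t) (at t)" if t: "0 < t" "t < L" for t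
  proof -
    have "(deriv P has_real_derivative (deriv ^^ 2) P t) (at t)"
      using smooth[OF t, of 1] by (simp add: real_differentiable_def numeral_2_eq_2) (metis DERIV_imp_deriv)
    then have "(d has_real_derivative (deriv ^^ 2) P t) (at t)"
      by (rule has_field_derivative_transform_within_open[where S = "{0<..<L}"]) (use t in \<open>auto simp: d_def\<close>)
    then show ?thesis using t by (simp add: d2_def)
  qed
  have d0: "d t = 0" if "t < \<delta> \<or> L - \<delta> < t" for t using that \<delta> by (auto simp: d_def)
  have d20: "d2 t = 0" if "t < \<delta> \<or> L - \<delta> < t" for t
  proof (cases "0 < t \<and> t < L")
    case True
    have "((\<lambda>t. 0) has_real_derivative d2 t) (at t)"
      by (rule has_field_derivative_transform_within_open[OF derd[of t], where S = "{..<\<delta>} \<union> {L-\<delta><..}"])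
        (use True that d0 in auto)
    then show ?thesis using DERIV_unique[of "\<lambda>t. 0"] DERIV_const by blast
  qed (auto simp: d2_def)
  have cont_ext: "continuous_on {0..L} h"
    if "\<And>t. t < \<delta> \<or> L - \<delta> < t \<Longrightarrow> h t = 0" "\<And>t. 0 < t \<Longrightarrow> t < L \<Longrightarrow> isCont h t" for h :: "real \<Rightarrow> real"
  proof (intro continuous_at_imp_continuous_on ballI)
    fix t assume t: "t \<in> {0..L}"
    show "isCont h t"
    proof (cases "0 < t \<and> t < L")
      case False
      have "\<forall>\<^sub>F x in nhds t. h x = 0"
        by (rule eventually_nhds_in_open[THEN eventually_mono, of "{..<\<delta>} \<union> {L-\<delta><..}"])
          (use False t \<delta>(1) that(1) in auto)
      then show ?thesis by (subst isCont_cong[of _ "\<lambda>x. 0"]) auto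
    qed (use that in blast)
  qed
  have cd: "continuous_on {0..L} d" using d0 derd by (intro cont_ext) (auto intro: DERIV_isCont)
  have cd2: "continuous_on {0..L} d2"
  proof (intro cont_ext d20)
    fix t assume t: "0 < t" "t < L"
    have "isCont ((deriv ^^ 2) P) t"
      using smooth[OF t, of 2] by (simp add: differentiable_imp_continuous_within)
    moreover have "\<forall>\<^sub>F x in nhds t. (deriv ^^ 2) P x = d2 x"
      by (rule eventually_nhds_in_open[THEN eventually_mono, of "{0<..<L}"]) (use t in \<open>auto simp: d2_def\<close>)
    ultimately show "isCont d2 t" by (simp add: isCont_cong)
  qed
  note cU = solution_continuous[OF sol]
  have cg: "continuous_on {0..L} g" using ac by (rule abs_continuous_on_imp_continuous_on)
  obtain B1 where B1: "0 < B1" "\<And>t. t \<in> {0..L} \<Longrightarrow> \<bar>P t\<bar> \<le> B1"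
    "\<And>s t. 0 \<le> s \<Longrightarrow> s < t \<Longrightarrow> t \<le> L \<Longrightarrow> \<bar>P t - P s\<bar> \<le> B1 * (t - s)"
    using lipschitz_bound_of_derivative[OF P cd derP] by blast
  obtain B2 where B2: "0 < B2" "\<And>t. t \<in> {0..L} \<Longrightarrow> \<bar>d t\<bar> \<le> B2"
    "\<And>s t. 0 \<le> s \<Longrightarrow> s < t \<Longrightarrow> t \<le> L \<Longrightarrow> \<bar>d t - d s\<bar> \<le> B2 * (t - s)"
    using lipschitz_bound_of_derivative[OF cd cd2 derd] by blast
  obtain B3 where B3: "0 < B3" "\<And>t. t \<in> {0..L} \<Longrightarrow> \<bar>U t\<bar> \<le> B3"
    "\<And>s t. 0 \<le> s \<Longrightarrow> s < t \<Longrightarrow> t \<le> L \<Longrightarrow> \<bar>U t - U s\<bar> \<le> B3 * (t - s)"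
    using lipschitz_bound_of_derivative[OF cU cg solution_deriv_interior[OF sol]] by blast
  obtain B4 where B4: "0 < B4" "\<And>t. t \<in> {0..L} \<Longrightarrow> \<bar>g t\<bar> \<le> B4"
    using compact_imp_bounded[OF compact_continuous_image[OF cg compact_Icc]] by (auto simp: bounded_pos)
  \<comment> \<open>The antiderivative of the integrand: differentiating gives
    \<open>U * (- P'' + Q * P)\<close> almost everywhere, since the two terms \<open>g * P'\<close>
    cancel.\<close>
  define W where "W t = g t * P t - U t * d t" for t
  define C where "C = B1 + B4 * B1 + B3 * B2 + B2 * B3"
  have acW: "abs_continuous_on 0 L W"
  proof (rule abs_continuous_on_dominated[OF ac])
    show "0 < C" using B1 B2 B3 B4 by (simp add: C_def add_pos_pos)
    fix s t assume st: "0 \<le> s" "s < t" "t \<le> L"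
    \<comment> \<open>Only the first summand contains an increment of \<open>g\<close>; the others
      are increments of Lipschitz functions times bounded factors.\<close>
    have "W t - W s = (g t - g s) * P t + g s * (P t - P s) - U t * (d t - d s) - d s * (U t - U s)"
      by (simp add: W_def algebra_simps)
    then have "\<bar>W t - W s\<bar> \<le> \<bar>g t - g s\<bar> * \<bar>P t\<bar> + \<bar>g s\<bar> * \<bar>P t - P s\<bar> + \<bar>U t\<bar> * \<bar>d t - d s\<bar> + \<bar>d s\<bar> * \<bar>U t - U s\<bar>"
      unfolding abs_mult[symmetric] by linarith
    also have "\<dots> \<le> \<bar>g t - g s\<bar> * B1 + B4 * (B1 * (t - s)) + B3 * (B2 * (t - s)) + B2 * (B3 * (t - s))"
      using st by (intro add_mono mult_mono B1 B2 B3 B4) (use B1 B2 B3 B4 in auto)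
    also have "\<dots> = B1 * \<bar>g t - g s\<bar> + (B4 * B1 + B3 * B2 + B2 * B3) * (t - s)"
      by (simp add: algebra_simps)
    also have "\<dots> \<le> C * \<bar>g t - g s\<bar> + C * (t - s)"
      using B1 B2 B3 B4 st unfolding C_def by (intro add_mono mult_right_mono) auto
    finally show "\<bar>W t - W s\<bar> \<le> C * (\<bar>g t - g s\<bar> + (t - s))" by (simp add: distrib_left)
  qed
  obtain N where N: "negligible N" "\<And>t. 0 < t \<Longrightarrow> t < L \<Longrightarrow> t \<notin> N \<Longrightarrow> (g has_real_derivative Q t * U t) (at t)"
    using ae unfolding eventually_ae_filter_negligible by fastforce
  define f where "f t = U t * (- (deriv ^^ 2) P t + Q t * P t)" for t
  have "(f has_integral W L - W 0) {0..L}"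
  proof (rule fundamental_theorem_of_calculus_abs_continuous[OF _ acW])
    show "negligible (N \<union> {0, L})" using N by (simp add: negligible_Un)
    fix t assume "t \<in> {0..L} - (N \<union> {0, L})"
    then have t: "0 < t" "t < L" "t \<notin> N" by auto
    have "(W has_real_derivative Q t * U t * P t + d t * g t - (g t * d t + d2 t * U t)) (at t)"
      unfolding W_def using N(2)[OF t] derP[OF t(1,2)] derd[OF t(1,2)] solution_deriv_interior[OF sol t(1,2)]
      by (intro DERIV_diff DERIV_mult)
    then show "(W has_real_derivative f t) (at t within {0..L})"
      using t by (simp add: f_def d2_def algebra_simps has_field_derivative_at_within)
  qed (use L in simp)
  \<comment> \<open>Absolute integrability of \<open>f\<close> is what allows the gauge integral to
    be read as a Lebesgue integral.\<close>
  moreover have "set_integrable lebesgue {0..L} f"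
  proof (rule absolutely_integrable_spike[where S = "{0, L}"])
    have m: "h \<in> borel_measurable (lebesgue_on {0..L})" if "continuous_on {0..L} h" for h :: "real \<Rightarrow> real"
      using that by (rule continuous_imp_measurable_on_sets_lebesgue) simp
    have "continuous_on {0..L} (\<lambda>t. U t * P t)" by (intro continuous_intros cU P)
    then have "set_integrable lebesgue {0..L} (\<lambda>t. (U t * P t) * Q t)"
      by (intro absolutely_integrable_bounded_measurable_product_real m Q)
        (auto intro!: compact_imp_bounded compact_continuous_image)
    moreover have "set_integrable lebesgue {0..L} (\<lambda>t. - (U t * d2 t))"
      by (intro absolutely_integrable_continuous_real continuous_intros cU cd2)
    ultimately show "set_integrable lebesgue {0..L} (\<lambda>t. - (U t * d2 t) + (U t * P t) * Q t)"
      by (intro set_integral_add)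
  qed (auto simp: f_def d2_def algebra_simps)
  ultimately have "(LINT t:{0..L}|lebesgue. f t) = W L - W 0"
    by (simp add: set_lebesgue_integral_eq_integral integral_unique)
  then show ?thesis by (simp add: f_def W_def d_def)
qed

text \<open>The fundamental theorem on each subinterval turns the equation almost everywhere into
  the equation for increments.\<close>

lemma solution_of_abs_continuous:
  assumes L: "0 < L" and Qpos: "\<And>t. t \<in> {0..L} \<Longrightarrow> 0 \<le> Q t" and Q: "set_integrable lebesgue {0..L} Q"
    and der: "\<And>t. t \<in> {0..L} \<Longrightarrow> (U has_real_derivative g t) (at t within {0..L})"
    and ac: "abs_continuous_on 0 L g"
    and ae: "AE t in lebesgue. t \<in> {0<..<L} \<longrightarrow> (g has_real_derivative Q t * U t) (at t)"
  shows "solution_on L Q U g"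
proof -
  obtain N where N: "negligible N" "\<And>t. 0 < t \<Longrightarrow> t < L \<Longrightarrow> t \<notin> N \<Longrightarrow> (g has_real_derivative Q t * U t) (at t)"
    using ae unfolding eventually_ae_filter_negligible by fastforce
  have "((\<lambda>t. Q t * U t) has_integral g b - g a) {a..b}" if ab: "0 \<le> a" "a \<le> b" "b \<le> L" for a b
  proof (rule fundamental_theorem_of_calculus_abs_continuous[OF ab(2)])
    show "abs_continuous_on a b g"
      unfolding abs_continuous_on_def
    proof (intro allI impI)
      fix e :: real assume "0 < e"
      from ac[unfolded abs_continuous_on_def, THEN spec, THEN mp, OF this]
      obtain d where d: "0 < d" and I: "\<forall>I. finite I \<and> (\<forall>(s, t)\<in>I. 0 \<le> s \<and> s < t \<and> t \<le> L) \<and>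
        pairwise (\<lambda>i j. {fst i<..<snd i} \<inter> {fst j<..<snd j} = {}) I \<and>
        (\<Sum>(s, t)\<in>I. t - s) < d \<longrightarrow> (\<Sum>(s, t)\<in>I. \<bar>g t - g s\<bar>) < e"
        by (elim exE conjE) (rule that)
      show "\<exists>\<delta>>0. \<forall>I. finite I \<and> (\<forall>(s, t)\<in>I. a \<le> s \<and> s < t \<and> t \<le> b) \<and>
        pairwise (\<lambda>i j. {fst i<..<snd i} \<inter> {fst j<..<snd j} = {}) I \<and>
        (\<Sum>(s, t)\<in>I. t - s) < \<delta> \<longrightarrow> (\<Sum>(s, t)\<in>I. \<bar>g t - g s\<bar>) < e"
      proof (intro exI[of _ d] conjI allI impI, rule d)
        fix I :: "(real \<times> real) set"
        assume "finite I \<and> (\<forall>(s, t)\<in>I. a \<le> s \<and> s < t \<and> t \<le> b) \<and>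
          pairwise (\<lambda>i j. {fst i<..<snd i} \<inter> {fst j<..<snd j} = {}) I \<and> (\<Sum>(s, t)\<in>I. t - s) < d"
        then show "(\<Sum>(s, t)\<in>I. \<bar>g t - g s\<bar>) < e"
          using ab by (intro I[THEN spec, THEN mp]) (auto split: prod.splits)
      qed
    qed
    show "negligible (N \<union> {a, b})" using N by (simp add: negligible_Un)
    show "(g has_real_derivative Q t * U t) (at t within {a..b})" if "t \<in> {a..b} - (N \<union> {a, b})" for t
      using N(2)[of t] that ab by (auto intro: has_field_derivative_at_within)
  qed
  moreover have "Q integrable_on {0..L}" using Q by (rule set_lebesgue_integral_eq_integral)
  ultimately show ?thesis using L Qpos der by (simp add: solution_on_def)
qed

section \<open>Metric graphs and their completion\<close>

locale completed_metric_graph =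
  fixes G :: "('a::metric_space, 'e) mgraph"
  assumes metric_graph: "metric_graph G" and connected: "graph_connected G"
    and completion: "has_completion G" and boundary_nonempty: "boundary G \<noteq> {}"
begin

lemma elen_pos: "e \<in> edges G \<Longrightarrow> 0 < elen G e"
  using metric_graph by (simp add: metric_graph_def)

lemma chart_inj:
  "e \<in> edges G \<Longrightarrow> s \<in> {0..elen G e} \<Longrightarrow> t \<in> {0..elen G e} \<Longrightarrow> chart G e s = chart G e t \<Longrightarrow> s = t"
  using metric_graph unfolding metric_graph_def inj_on_def by metis

lemma ends_in_verts: "e \<in> edges G \<Longrightarrow> v \<in> ends G e \<Longrightarrow> v \<in> verts G"
  using metric_graph by (auto simp: metric_graph_def)

lemma chart_interior_not_vert:
  assumes "e \<in> edges G" "0 < t" "t < elen G e"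
  shows "chart G e t \<notin> verts G"
proof -
  have "chart G e ` {0<..<elen G e} \<inter> verts G = {}"
    using metric_graph assms(1) by (simp add: metric_graph_def)
  moreover have "chart G e t \<in> chart G e ` {0<..<elen G e}" using assms by simp
  ultimately show ?thesis by blast
qed

lemma chart_in_points: "e \<in> edges G \<Longrightarrow> t \<in> {0..elen G e} \<Longrightarrow> chart G e t \<in> points G"
  unfolding points_def by blast

lemma verts_subset_points: "verts G \<subseteq> points G"
  by (simp add: points_def)

lemma points_subset_gbar: "points G \<subseteq> gbar G"
  unfolding gbar_def by (rule closure_subset)

lemma finite_incident: "v \<in> verts G \<Longrightarrow> finite (incident G v)"
  using metric_graph by (simp add: metric_graph_def)

lemma chart_endpoint:
  "e \<in> edges G \<Longrightarrow> t \<in> {0..elen G e} \<Longrightarrow> chart G e t \<in> verts G \<Longrightarrow> t = 0 \<or> t = elen G e"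
  using chart_interior_not_vert[of e t] by force

text \<open>Open edges are disjoint from each other and contain no vertex, so two edges can meet
  only in a vertex, and a vertex on an edge is an end of it.\<close>

lemma common_point_is_end:
  assumes "e \<in> edges G" "e' \<in> edges G" "e \<noteq> e'" "s \<in> {0..elen G e}" "s' \<in> {0..elen G e'}"
    and eq: "chart G e s = chart G e' s'"
  shows "chart G e s \<in> ends G e \<inter> ends G e'"
proof -
  have "chart G e s \<in> verts G"
  proof (rule ccontr)
    assume nv: "chart G e s \<notin> verts G"
    have "s \<noteq> 0" "s \<noteq> elen G e" "s' \<noteq> 0" "s' \<noteq> elen G e'"
      using nv eq ends_in_verts assms(1,2) unfolding ends_def by auto
    then have "s \<in> {0<..<elen G e}" "s' \<in> {0<..<elen G e'}" using assms by auto
    then have "chart G e s \<in> chart G e ` {0<..<elen G e}" "chart G e' s' \<in> chart G e' ` {0<..<elen G e'}"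
      by auto
    moreover have "chart G e ` {0<..<elen G e} \<inter> chart G e' ` {0<..<elen G e'} = {}"
      using metric_graph assms(1-3) by (simp add: metric_graph_def)
    ultimately show False using eq by auto
  qed
  then show ?thesis using chart_endpoint[of e s] chart_endpoint[of e' s'] assms by (auto simp: ends_def)
qed

lemma chart_from_cases:
  assumes "v \<in> ends G e" "e \<in> edges G"
  obtains "v = chart G e 0" "chart_from G v e = chart G e"
  | "v = chart G e (elen G e)" "chart_from G v e = (\<lambda>t. chart G e (elen G e - t))"
proof (cases "v = chart G e 0")
  case True
  with that(1) show thesis by (auto simp: chart_from_def fun_eq_iff)
next
  case False
  with that(2) assms show thesis by (auto simp: chart_from_def fun_eq_iff ends_def)
qed

lemma chart_from_image:
  assumes "v \<in> ends G e" "e \<in> edges G"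
  shows "chart_from G v e ` {0..elen G e} = chart G e ` {0..elen G e}"
proof (cases rule: chart_from_cases[OF assms])
  case 2
  have "(\<lambda>t. elen G e - t) ` {0..elen G e} = {0..elen G e}" by (force simp: image_iff)
  then have "(\<lambda>t. chart G e (elen G e - t)) ` {0..elen G e} = chart G e ` {0..elen G e}"
    by (metis image_image)
  with 2 show ?thesis by simp
qed simp

lemma chart_from_0: "v \<in> ends G e \<Longrightarrow> e \<in> edges G \<Longrightarrow> chart_from G v e 0 = v"
  by (erule chart_from_cases) auto

section \<open>Paths, distances and isolation of the vertices\<close>

lemma joined_nonneg: "joined G p q r \<Longrightarrow> 0 \<le> r"
  by (induction rule: joined.induct) auto

lemma joined_points: "joined G p q r \<Longrightarrow> p \<in> points G \<and> q \<in> points G"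
  by (induction rule: joined.induct) (auto intro: chart_in_points)

lemma dist_le_joined: "joined G p q r \<Longrightarrow> dist p q \<le> r"
  using completion joined_points[of p q r] unfolding has_completion_def gdist_def
  by (auto intro!: cInf_lower bdd_belowI[of _ 0] joined_nonneg)

lemma joined_if_dist_less:
  assumes "p \<in> points G" "q \<in> points G" "dist p q < r"
  obtains l where "joined G p q l" "l < r"
proof -
  have "Inf {r. joined G p q r} < r"
    using completion assms unfolding has_completion_def gdist_def by auto
  moreover have "{r. joined G p q r} \<noteq> {}"
    using connected assms unfolding graph_connected_def by blast
  ultimately obtain l where "l \<in> {r. joined G p q r}" "l < r" using cInf_lessD by meson
  with that show thesis by simp
qed

lemma dist_chart_le:
  assumes "e \<in> edges G" "s \<in> {0..elen G e}" "t \<in> {0..elen G e}"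
  shows "dist (chart G e s) (chart G e t) \<le> \<bar>t - s\<bar>"
  using dist_le_joined[OF joined.step[OF joined.start assms]] chart_in_points assms by simp

lemma continuous_on_chart:
  assumes "e \<in> edges G"
  shows "continuous_on {0..elen G e} (chart G e)"
proof (unfold continuous_on_iff, intro ballI allI impI)
  fix t r :: real assume t: "t \<in> {0..elen G e}" and r: "0 < r"
  have "dist (chart G e s) (chart G e t) < r" if "s \<in> {0..elen G e}" "dist s t < r" for s
    using dist_chart_le[OF assms that(1) t] that(2) by (simp add: dist_real_def abs_minus_commute)
  with r show "\<exists>d>0. \<forall>s\<in>{0..elen G e}. dist s t < d \<longrightarrow> dist (chart G e s) (chart G e t) < r" by blast
qed

lemma closed_chart_image: "e \<in> edges G \<Longrightarrow> closed (chart G e ` {0..elen G e})"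
  by (intro compact_imp_closed compact_continuous_image continuous_on_chart) auto

text \<open>A point on no edge could be joined to itself only. The graph would then be a single
  vertex of degree 0, already complete, and its boundary would be empty.\<close>

lemma point_on_edge:
  assumes "p \<in> points G"
  obtains e t where "e \<in> edges G" "t \<in> {0..elen G e}" "p = chart G e t"
proof (rule ccontr)
  assume "\<not> thesis"
  with that have no: "\<not> (\<exists>e\<in>edges G. p \<in> chart G e ` {0..elen G e})" by blast
  have "q = p" if "joined G p q r" for q r
    using that no by (induction rule: joined.induct) blast+
  then have "points G = {p}" using connected assms unfolding graph_connected_def by blast
  moreover from this have "gbar G = {p}" by (simp add: gbar_def)
  moreover have "incident G p = {}"
  proof (rule ccontr)
    assume "incident G p \<noteq> {}"
    then obtain e where "e \<in> edges G" "p \<in> ends G e" by (auto simp: incident_def)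
    then have "p \<in> chart G e ` {0..elen G e}" using elen_pos[of e] by (auto simp: ends_def)
    with no \<open>e \<in> edges G\<close> show False by blast
  qed
  ultimately have "boundary G = {}" using verts_subset_points by (auto simp: boundary_def degree_of_def)
  with boundary_nonempty show False by blast
qed

text \<open>A path passes from one edge to another through a common end, so it never leaves the
  edges of \<open>T\<close>. Used to spread a property from one edge to the whole graph.\<close>

lemma edges_adjacency_connected:
  assumes "T \<subseteq> edges G" "T \<noteq> {}"
    and adj: "\<And>e e' v. e \<in> T \<Longrightarrow> e' \<in> edges G \<Longrightarrow> e \<noteq> e' \<Longrightarrow> v \<in> ends G e \<Longrightarrow> v \<in> ends G e' \<Longrightarrow> e' \<in> T"
  shows "T = edges G"
proof -
  obtain e0 where e0: "e0 \<in> T" using assms(2) by blast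
  define p where "p = chart G e0 0"
  have covered: "\<exists>e\<in>T. \<exists>t\<in>{0..elen G e}. q = chart G e t"
    if "joined G p q r" "\<exists>e\<in>T. \<exists>t\<in>{0..elen G e}. p = chart G e t" for p q r
    using that
  proof (induction rule: joined.induct)
    case (start p')
    then show ?case by simp
  next
    case (step p' e s r t)
    from step.IH[OF step.prems] obtain e' t'
      where e': "e' \<in> T" "t' \<in> {0..elen G e'}" "chart G e s = chart G e' t'" by blast
    have "e \<in> T"
    proof (cases "e = e'")
      case False
      then show ?thesis using common_point_is_end[of e e' s t'] adj[of e' e] e' step.hyps assms(1) by blast
    qed (use e' in simp)
    then show ?case using step.hyps by blast
  qed
  have "e \<in> T" if e: "e \<in> edges G" for e
  proof -
    \<comment> \<open>The midpoint is not a vertex, so an edge of \<open>T\<close> that contains it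
      can only be \<open>e\<close>.\<close>
    define t where "t = elen G e / 2"
    have t: "0 < t" "t < elen G e" "t \<in> {0..elen G e}" using elen_pos[OF e] by (auto simp: t_def)
    have "p \<in> points G" using e0 assms(1) elen_pos[of e0] by (auto simp: p_def intro!: chart_in_points)
    then obtain r where "joined G p (chart G e t) r"
      using connected chart_in_points[OF e t(3)] unfolding graph_connected_def by blast
    moreover have "\<exists>e\<in>T. \<exists>t\<in>{0..elen G e}. p = chart G e t"
      using e0 elen_pos[of e0] assms(1) by (intro bexI[of _ e0] bexI[of _ 0]) (auto simp: p_def)
    ultimately obtain e' t' where e': "e' \<in> T" "t' \<in> {0..elen G e'}" "chart G e t = chart G e' t'"
      using covered by blast
    show ?thesis
    proof (cases "e = e'")
      case False
      then have "chart G e t \<in> ends G e"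
        using common_point_is_end[of e e' t t'] e e' t assms(1) by blast
      then show ?thesis using chart_interior_not_vert[OF e t(1,2)] ends_in_verts[OF e] by blast
    qed (use e' in simp)
  qed
  with assms(1) show ?thesis by blast
qed

text \<open>While its length is below the distance to the nearer end, the path cannot have passed a
  vertex. It is still on \<open>e\<close>, and its length bounds the displacement of the
  coordinate.\<close>

lemma joined_from_interior:
  assumes e: "e \<in> edges G" and t: "t \<in> {0..elen G e}"
  assumes "joined G (chart G e t) q l"
  shows "min t (elen G e - t) \<le> l \<or> (\<exists>s\<in>{0..elen G e}. q = chart G e s \<and> \<bar>s - t\<bar> \<le> l)"
  using assms(3)
proof (induction "chart G e t" q l rule: joined.induct)
  case start
  then show ?case using t by auto
next
  case (step e' s r s')
  show ?case
  proof (cases "min t (elen G e - t) \<le> r")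
    case False
    then obtain x where x: "x \<in> {0..elen G e}" "chart G e' s = chart G e x" "\<bar>x - t\<bar> \<le> r"
      using step by auto
    have "e' = e"
    proof (rule ccontr)
      assume "e' \<noteq> e"
      then have "chart G e x \<in> ends G e"
        using common_point_is_end[of e e' x s] e step.hyps x by auto
      then have "x = 0 \<or> x = elen G e" using chart_endpoint[OF e x(1)] ends_in_verts[OF e] by blast
      with x False t show False by auto
    qed
    moreover have "x = s" using x step.hyps chart_inj[OF e] \<open>e' = e\<close> by blast
    ultimately show ?thesis using step.hyps x by (intro disjI2 bexI[of _ s']) auto
  qed auto
qed

lemma chart_from_shift:
  assumes "v \<in> ends G e" "e \<in> edges G" "s \<in> {0..elen G e}" "t \<in> {0..elen G e}" "x \<in> {0..elen G e}"
    and "chart G e s = chart_from G v e x"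
  shows "\<exists>y\<in>{0..elen G e}. chart G e t = chart_from G v e y \<and> \<bar>y - x\<bar> = \<bar>t - s\<bar>"
proof (cases rule: chart_from_cases[OF assms(1,2)])
  case 1
  then have "s = x" using assms chart_inj by metis
  then show ?thesis using 1 assms by (intro bexI[of _ t]) auto
next
  case 2
  then have "s = elen G e - x" using assms by (intro chart_inj[OF assms(2)]) auto
  then show ?thesis using 2 assms by (intro bexI[of _ "elen G e - t"]) auto
qed

lemma chart_from_interior_not_vert:
  assumes "v \<in> ends G e" "e \<in> edges G" "0 < t" "t < elen G e"
  shows "chart_from G v e t \<notin> verts G"
  by (cases rule: chart_from_cases[OF assms(1,2)])
    (use assms chart_interior_not_vert[of e t] chart_interior_not_vert[of e "elen G e - t"] in auto)

text \<open>A path from \<open>v\<close> shorter than every edge at \<open>v\<close> stays in the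
  star of \<open>v\<close>. The bound \<open>s \<le> l\<close> lets the induction see that the far
  end of an edge has not been reached.\<close>

lemma joined_from_vert:
  assumes v: "e0 \<in> incident G v" and r: "\<And>e. e \<in> incident G v \<Longrightarrow> r \<le> elen G e"
  assumes "joined G v q l"
  shows "r \<le> l \<or> (\<exists>e\<in>incident G v. \<exists>s\<in>{0..elen G e}. q = chart_from G v e s \<and> s \<le> l)"
  using assms(3,1,2)
proof (induction v q l rule: joined.induct)
  case (start v)
  then show ?case
    using elen_pos[of e0] chart_from_0[of v e0]
    by (intro disjI2 bexI[of _ e0] bexI[of _ 0]) (auto simp: incident_def)
next
  case (step v e s l t)
  note r = step.prems(2)
  show ?case
  proof (cases "r \<le> l")
    case False
    then obtain e' x where e': "e' \<in> incident G v" "x \<in> {0..elen G e'}" "chart G e s = chart_from G v e' x" "x \<le> l"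
      using step.IH[OF step.prems] by blast
    then have e'2: "v \<in> ends G e'" "e' \<in> edges G" by (auto simp: incident_def)
    have "\<exists>x. e \<in> incident G v \<and> chart G e s = chart_from G v e x \<and> x \<in> {0..elen G e} \<and> x \<le> l"
    proof (cases "e = e'")
      case True
      with e' show ?thesis by blast
    next
      case ne: False
      have "chart G e s \<in> chart G e' ` {0..elen G e'}"
        using chart_from_image[OF e'2] e' by blast
      then obtain y where "y \<in> {0..elen G e'}" "chart G e s = chart G e' y" by blast
      then have sh: "chart G e s \<in> ends G e \<inter> ends G e'"
        using common_point_is_end[of e e' s y] ne step.hyps e'2 by blast
      have "x < elen G e'" using r[OF e'(1)] e'(4) False by simp
      \<comment> \<open>The path changes edges here, hence at a vertex; being short of the far end
        of \<open>e'\<close>, it can only be at \<open>v\<close>.\<close>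
      have "x = 0"
      proof (rule ccontr)
        assume "x \<noteq> 0"
        then have "chart_from G v e' x \<notin> verts G"
          using e' \<open>x < elen G e'\<close> by (intro chart_from_interior_not_vert e'2) auto
        then show False using sh e' ends_in_verts[OF e'2(2)] by simp
      qed
      then have cv: "chart G e s = v" using e' chart_from_0[OF e'2] by simp
      then have "v \<in> ends G e" using sh by blast
      moreover have "0 \<le> l" using joined_nonneg step.hyps by blast
      ultimately show ?thesis
        using chart_from_0[of v e] step.hyps elen_pos[of e] cv by (intro exI[of _ 0]) (auto simp: incident_def)
    qed
    then obtain x where x: "e \<in> incident G v" "chart G e s = chart_from G v e x" "x \<in> {0..elen G e}" "x \<le> l"
      by blast
    obtain y where "y \<in> {0..elen G e}" "chart G e t = chart_from G v e y" "\<bar>y - x\<bar> = \<bar>t - s\<bar>"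
      using chart_from_shift[of v e s t x] x step.hyps by (auto simp: incident_def)
    with x show ?thesis by (intro disjI2 bexI[of _ e] bexI[of _ y]) auto
  qed auto
qed

lemma vert_incident:
  assumes "v \<in> verts G"
  shows "incident G v \<noteq> {}"
proof -
  obtain e t where e: "e \<in> edges G" "t \<in> {0..elen G e}" "v = chart G e t"
    using point_on_edge assms verts_subset_points by blast
  then have "e \<in> incident G v" using chart_endpoint[of e t] assms by (auto simp: incident_def ends_def)
  then show ?thesis by blast
qed

text \<open>The radius is the length of the shortest incident edge at a vertex, positive by local
  finiteness, and the distance to the nearer end at an inner point of an edge.\<close>

lemma verts_isolated:
  assumes p: "p \<in> points G"
  obtains r where "0 < r" "\<And>w. w \<in> verts G \<Longrightarrow> w \<noteq> p \<Longrightarrow> r \<le> dist p w"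
proof (cases "p \<in> verts G")
  case True
  define r where "r = Min (elen G ` incident G p)"
  note fin = finite_incident[OF True] and ne = vert_incident[OF True]
  have "0 < r" using fin ne by (auto simp: r_def incident_def intro: elen_pos)
  moreover have "r \<le> dist p w" if w: "w \<in> verts G" "w \<noteq> p" for w
  proof (rule ccontr)
    assume "\<not> r \<le> dist p w"
    then obtain l where l: "joined G p w l" "l < r"
      using joined_if_dist_less[of p w r] p w verts_subset_points by auto
    moreover have rmin: "r \<le> elen G e" if "e \<in> incident G p" for e
      using that fin by (simp add: r_def)
    ultimately obtain e s where e: "e \<in> incident G p" "s \<in> {0..elen G e}" "w = chart_from G p e s" "s \<le> l"
      using joined_from_vert[of _ p r w l] ne by fastforce
    have "s \<noteq> 0" using e w chart_from_0[of p e] by (auto simp: incident_def)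
    then show False
      using chart_from_interior_not_vert[of p e s] e w rmin[of e] l by (auto simp: incident_def)
  qed
  ultimately show thesis by (rule that)
next
  case False
  obtain e t where e: "e \<in> edges G" "t \<in> {0..elen G e}" "p = chart G e t"
    using point_on_edge[OF p] by blast
  have t: "0 < t" "t < elen G e" using False e ends_in_verts[OF e(1)]
    by (auto simp: ends_def order_less_le)
  have "min t (elen G e - t) \<le> dist p w" if w: "w \<in> verts G" "w \<noteq> p" for w
  proof (rule ccontr)
    assume "\<not> min t (elen G e - t) \<le> dist p w"
    then have "dist p w < min t (elen G e - t)" by linarith
    then obtain l where l: "joined G p w l" "l < min t (elen G e - t)"
      using joined_if_dist_less p w verts_subset_points by blast
    then obtain s where s: "s \<in> {0..elen G e}" "w = chart G e s" "\<bar>s - t\<bar> \<le> l"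
      using joined_from_interior[of e t w l] e by auto
    then show False using chart_interior_not_vert[of e s] e w l by auto
  qed
  moreover have "0 < min t (elen G e - t)" using t by simp
  ultimately show thesis using that by blast
qed

text \<open>An infinite \<open>D\<close> would have a limit point in the compact completion.
  Isolation of the vertices rules out the points of the graph, and \<open>away\<close> rules out the
  ideal points.\<close>

lemma finite_vert_set:
  assumes "compact (gbar G)" "D \<subseteq> verts G"
    and away: "\<And>x. x \<in> gbar G - points G \<Longrightarrow> \<exists>r>0. \<forall>v\<in>D. r \<le> dist x v"
  shows "finite D"
proof (rule ccontr)
  assume "infinite D"
  moreover have "D \<subseteq> gbar G" using assms(2) verts_subset_points points_subset_gbar by blast
  ultimately obtain x where x: "x \<in> gbar G" "x islimpt D"
    using assms(1) unfolding compact_eq_Bolzano_Weierstrass by blast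
  have "\<exists>r>0. \<forall>v\<in>D. v \<noteq> x \<longrightarrow> r \<le> dist x v"
  proof (cases "x \<in> points G")
    case True
    from verts_isolated[OF this] obtain r where "0 < r" "\<And>w. w \<in> verts G \<Longrightarrow> w \<noteq> x \<Longrightarrow> r \<le> dist x w"
      by blast
    then show ?thesis using assms(2) by blast
  next
    case False
    then show ?thesis using away[of x] x by blast
  qed
  then obtain r where "0 < r" "\<And>v. v \<in> D \<Longrightarrow> v \<noteq> x \<Longrightarrow> r \<le> dist x v" by blast
  with x(2) show False unfolding islimpt_approachable by (fastforce simp: dist_commute)
qed

lemma degree_ge_2:
  assumes "v \<in> verts G" "v \<notin> boundary G"
  shows "2 \<le> degree_of G v"
proof -
  have "degree_of G v \<noteq> 0" using vert_incident[OF assms(1)] finite_incident[OF assms(1)] by (auto simp: degree_of_def)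
  moreover have "degree_of G v \<noteq> 1" using assms by (auto simp: boundary_def)
  ultimately show ?thesis by linarith
qed

lemma shared_end_not_boundary:
  assumes "e \<in> edges G" "e' \<in> edges G" "e \<noteq> e'" "v \<in> ends G e" "v \<in> ends G e'"
  shows "v \<notin> boundary G"
proof -
  have v: "v \<in> verts G" using ends_in_verts assms by blast
  have "card {e, e'} \<le> card (incident G v)"
    using assms finite_incident[OF v] by (intro card_mono) (auto simp: incident_def)
  then have "degree_of G v \<noteq> 1" using assms(3) by (simp add: degree_of_def)
  moreover have "v \<in> points G" using v verts_subset_points by blast
  ultimately show ?thesis by (simp add: boundary_def)
qed

lemma boundary_subset_gbar: "boundary G \<subseteq> gbar G"
  using verts_subset_points points_subset_gbar unfolding boundary_def by blast

end

section \<open>The maximum principle\<close>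

locale harmonic_setting = completed_metric_graph G
  for G :: "('a::metric_space, 'e) mgraph" +
  fixes q u :: "'a \<Rightarrow> real" and \<Omega> :: "'a set"
  assumes compact_gbar: "compact (gbar G)" and potential: "admissible_potential G q"
    and extension: "harmonic_extension G q (indicator \<Omega>) u"
    and \<Omega>_subset: "\<Omega> \<subseteq> boundary G" and \<Omega>_nonempty: "\<Omega> \<noteq> {}" and \<Omega>_proper: "\<Omega> \<noteq> boundary G"
begin

lemma continuous_u: "continuous_on (gbar G) u"
  using extension by (simp add: harmonic_extension_def)

lemma u_boundary: "x \<in> boundary G \<Longrightarrow> u x = indicator \<Omega> x"
  using extension by (simp add: harmonic_extension_def)

lemma potential_nonneg: "x \<in> points G \<Longrightarrow> 0 \<le> q x"
  using potential by (simp add: admissible_potential_def)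

lemma potential_edge_integrable:
  "e \<in> edges G \<Longrightarrow> set_integrable lebesgue {0..elen G e} (\<lambda>t. q (chart G e t))"
  using potential by (simp add: admissible_potential_def edgewise_integrable_def)

lemma kirchhoff:
  assumes "v \<in> verts G" "v \<notin> boundary G"
  shows "(\<Sum>e\<in>incident G v. normal_deriv G u v e) = 0"
  using extension degree_ge_2[OF assms] assms(1) by (simp add: harmonic_extension_def harmonic_def)

text \<open>At the right end the coordinate starting at the vertex runs backwards, hence the minus
  sign in the last property.\<close>

lemma edge_solution_chart:
  assumes e: "e \<in> edges G"
  obtains g where
    "solution_on (elen G e) (\<lambda>t. q (chart G e t)) (\<lambda>t. u (chart G e t)) g"
    "abs_continuous_on 0 (elen G e) g"
    "AE t in lebesgue. t \<in> {0<..<elen G e} \<longrightarrow> (g has_real_derivative q (chart G e t) * u (chart G e t)) (at t)"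
    "normal_deriv G u (chart G e 0) e = g 0"
    "normal_deriv G u (chart G e (elen G e)) e = - g (elen G e)"
proof -
  let ?L = "elen G e"
  note L = elen_pos[OF e]
  obtain g where g: "\<And>t. t \<in> {0..?L} \<Longrightarrow> ((\<lambda>s. u (chart G e s)) has_real_derivative g t) (at t within {0..?L})"
    and ac: "abs_continuous_on 0 ?L g"
    and ae: "AE t in lebesgue. t \<in> {0<..<?L} \<longrightarrow> (g has_real_derivative q (chart G e t) * u (chart G e t)) (at t)"
    using extension e unfolding harmonic_extension_def harmonic_def by blast
  have sol: "solution_on ?L (\<lambda>t. q (chart G e t)) (\<lambda>t. u (chart G e t)) g"
    by (rule solution_of_abs_continuous[OF L _ potential_edge_integrable[OF e] g ac ae])
      (intro potential_nonneg chart_in_points e)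
  have vd: "vector_derivative f (at 0 within {0..?L}) = D"
    if "(f has_real_derivative D) (at 0 within {0..?L})" for f D
    using that L by (intro vector_derivative_within_cbox[of 0 ?L, simplified])
      (auto simp: has_real_derivative_iff_has_vector_derivative)
  have c0: "chart_from G (chart G e 0) e = chart G e" by (simp add: chart_from_def fun_eq_iff)
  have "chart G e 0 \<noteq> chart G e ?L" using chart_inj[OF e, of 0 ?L] L by auto
  then have cL: "chart_from G (chart G e ?L) e = (\<lambda>t. chart G e (?L - t))"
    by (simp add: chart_from_def fun_eq_iff)
  have "normal_deriv G u (chart G e 0) e = g 0"
    unfolding normal_deriv_def c0 by (rule vd) (use g L in simp)
  moreover have "normal_deriv G u (chart G e ?L) e = - g ?L"
    unfolding normal_deriv_def cL
    by (rule vd) (use solution_deriv[OF solution_reflect[OF sol], of 0] L in simp)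
  ultimately show thesis using that[OF sol ac ae] by blast
qed

text \<open>The edge \<open>e\<close> with ends \<open>v\<close> and \<open>w\<close>, in the local coordinate starting at \<open>v\<close>.\<close>

definition oriented :: "'e \<Rightarrow> 'a \<Rightarrow> 'a \<Rightarrow> (real \<Rightarrow> real) \<Rightarrow> bool" where
  "oriented e v w g \<longleftrightarrow> ends G e = {v, w} \<and> v \<noteq> w \<and>
     chart_from G v e 0 = v \<and> chart_from G v e (elen G e) = w \<and>
     solution_on (elen G e) (\<lambda>t. q (chart_from G v e t)) (\<lambda>t. u (chart_from G v e t)) g \<and>
     normal_deriv G u v e = g 0 \<and> normal_deriv G u w e = - g (elen G e)"

lemma oriented_exists:
  assumes e: "e \<in> edges G" and v: "v \<in> ends G e"
  obtains w g where "oriented e v w g"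
proof -
  let ?L = "elen G e"
  obtain g where g: "solution_on ?L (\<lambda>t. q (chart G e t)) (\<lambda>t. u (chart G e t)) g"
    "normal_deriv G u (chart G e 0) e = g 0" "normal_deriv G u (chart G e ?L) e = - g ?L"
    using edge_solution_chart[OF e] by metis
  have ne: "chart G e 0 \<noteq> chart G e ?L" using chart_inj[OF e, of 0 ?L] elen_pos[OF e] by auto
  show thesis
  proof (cases rule: chart_from_cases[OF v e])
    case 1
    then have "oriented e v (chart G e ?L) g"
      using g ne unfolding oriented_def by (simp add: ends_def)
    then show thesis by (rule that)
  next
    case 2
    then have "oriented e v (chart G e 0) (\<lambda>t. - g (?L - t))"
      using g(2,3) ne solution_reflect[OF g(1)] unfolding oriented_def by (auto simp: ends_def)
    then show thesis by (rule that)
  qed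
qed

lemma chart_from_in_points:
  assumes "e \<in> edges G" "v \<in> ends G e" "t \<in> {0..elen G e}"
  shows "chart_from G v e t \<in> points G"
  using imageI[OF assms(3), of "chart_from G v e"] chart_in_points[OF assms(1)]
  unfolding chart_from_image[OF assms(2,1)] by auto

lemma chart_from_interior_not_boundary:
  assumes "e \<in> edges G" "v \<in> ends G e" "0 < t" "t < elen G e"
  shows "chart_from G v e t \<in> points G - boundary G"
  using chart_from_in_points[of e v t] chart_from_interior_not_vert[of v e t] assms by (simp add: boundary_def)

text \<open>Minimum and maximum principle in one, with \<open>\<sigma> = 1\<close> and
  \<open>\<sigma> = - 1\<close>. At an inner vertex with the extreme value all normal derivatives
  have the same sign and sum to 0, so each of them vanishes. By \<open>uniq\<close> the function is
  then constant on all incident edges, and the value spreads over the graph and, by density, over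
  its completion.\<close>

lemma u_constant_if:
  assumes ext: "(\<forall>x\<in>points G. m \<le> u x) \<or> (\<forall>x\<in>points G. u x \<le> m)"
    and sgn: "\<sigma> \<noteq> 0" "\<And>e v. e \<in> incident G v \<Longrightarrow> u v = m \<Longrightarrow> 0 \<le> \<sigma> * normal_deriv G u v e"
    and uniq: "\<And>e v w g s t. \<lbrakk>e \<in> edges G; v \<in> ends G e; oriented e v w g; s \<in> {0..elen G e};
        u (chart_from G v e s) = m; g s = 0; t \<in> {0..elen G e}\<rbrakk> \<Longrightarrow> u (chart_from G v e t) = m"
    and p: "p \<in> points G - boundary G" "u p = m" and x: "x \<in> gbar G"
  shows "u x = m"
proof -
  define T where "T = {e \<in> edges G. \<forall>y\<in>chart G e ` {0..elen G e}. u y = m}"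
  have T_I: "e \<in> T" if e: "e \<in> edges G" and v: "v \<in> ends G e" and or: "oriented e v w g"
      and s: "s \<in> {0..elen G e}" "u (chart_from G v e s) = m" "g s = 0" for e v w g s
  proof -
    have "\<forall>y\<in>chart_from G v e ` {0..elen G e}. u y = m" using uniq[OF e v or s] by auto
    then show ?thesis using e chart_from_image[OF v e] by (simp add: T_def)
  qed
  have vert: "e \<in> T" if v: "v \<in> verts G" "v \<notin> boundary G" "u v = m" and e: "e \<in> incident G v" for v e
  proof -
    have "(\<Sum>e\<in>incident G v. \<sigma> * normal_deriv G u v e) = 0"
      using kirchhoff[OF v(1,2)] by (simp add: sum_distrib_left[symmetric])
    then have "\<forall>e\<in>incident G v. \<sigma> * normal_deriv G u v e = 0"
      using sgn(2)[OF _ v(3)] finite_incident[OF v(1)] by (subst (asm) sum_nonneg_eq_0_iff) auto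
    then have nd: "normal_deriv G u v e = 0" using e sgn(1) by simp
    have e2: "e \<in> edges G" "v \<in> ends G e" using e by (auto simp: incident_def)
    obtain w g where or: "oriented e v w g" using oriented_exists[OF e2] .
    then show "e \<in> T"
      using nd v elen_pos[OF e2(1)] by (intro T_I[OF e2 or, of 0]) (auto simp: oriented_def)
  qed
  have "T \<noteq> {}"
  proof (cases "p \<in> verts G")
    case True
    then show ?thesis using vert[of p] p vert_incident[of p] by auto
  next
    case False
    obtain e t where e: "e \<in> edges G" "t \<in> {0..elen G e}" "p = chart G e t"
      using point_on_edge p by blast
    have v: "chart G e 0 \<in> ends G e" by (simp add: ends_def)
    obtain w g where or: "oriented e (chart G e 0) w g" using oriented_exists[OF e(1) v] .
    have cf: "chart_from G (chart G e 0) e = chart G e" by (simp add: chart_from_def fun_eq_iff)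
    have t: "0 < t" "t < elen G e"
      using False e ends_in_verts[OF e(1)] by (auto simp: ends_def order_less_le)
    have "g t = 0"
    proof (rule solution_interior_extremum[OF _ t])
      show "solution_on (elen G e) (\<lambda>t. q (chart G e t)) (\<lambda>t. u (chart G e t)) g"
        using or by (simp add: oriented_def cf)
      show "(\<forall>s\<in>{0..elen G e}. u (chart G e t) \<le> u (chart G e s)) \<or>
            (\<forall>s\<in>{0..elen G e}. u (chart G e s) \<le> u (chart G e t))"
        using ext p(2) e(3) chart_in_points[OF e(1)] by auto
    qed
    then have "e \<in> T" using e p by (intro T_I[OF e(1) v or e(2)]) (auto simp: cf)
    then show ?thesis by blast
  qed
  \<comment> \<open>A common end of two edges has degree at least 2, so Kirchhoff's law holds there
    and the value is handed on to the next edge.\<close>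
  have "T = edges G"
  proof (rule edges_adjacency_connected)
    show "T \<subseteq> edges G" by (auto simp: T_def)
    fix e e' v
    assume *: "e \<in> T" "e' \<in> edges G" "e \<noteq> e'" "v \<in> ends G e" "v \<in> ends G e'"
    then have e: "e \<in> edges G" by (simp add: T_def)
    have "v \<in> chart G e ` {0..elen G e}" using *(4) elen_pos[OF e] by (auto simp: ends_def)
    then have "u v = m" using *(1) by (auto simp: T_def)
    then show "e' \<in> T"
      using vert[of v e'] shared_end_not_boundary[OF e *(2-5)] ends_in_verts[OF e *(4)] *
      by (simp add: incident_def)
  qed (rule \<open>T \<noteq> {}\<close>)
  have "u y = m" if y: "y \<in> points G" for y
  proof -
    obtain e t where e: "e \<in> edges G" "t \<in> {0..elen G e}" "y = chart G e t" using point_on_edge[OF y] .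
    then have "e \<in> T" using \<open>T = edges G\<close> by simp
    with e show ?thesis by (simp add: T_def)
  qed
  then show ?thesis
    using continuous_constant_on_closure[of "points G" u m x] continuous_u x unfolding gbar_def by blast
qed

lemma gbar_nonempty: "gbar G \<noteq> {}"
  using boundary_nonempty boundary_subset_gbar by blast

lemma gbar_cases: "x \<in> gbar G \<Longrightarrow> x \<in> boundary G \<or> x \<in> points G - boundary G"
  by (auto simp: boundary_def)

lemma oriented_left:
  assumes "oriented e v w g" "e \<in> edges G"
  shows "v \<in> ends G e" "w \<in> ends G e" "0 < elen G e"
  using assms elen_pos by (auto simp: oriented_def)

lemma u_minimum_unique:
  assumes m: "m \<le> 0" "\<And>x. x \<in> points G \<Longrightarrow> m \<le> u x" and p: "p \<in> points G - boundary G" "u p = m"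
    and x: "x \<in> gbar G"
  shows "u x = m"
proof (rule u_constant_if[OF _ _ _ _ p x, where \<sigma> = 1])
  fix e v assume "e \<in> incident G v" and uv: "u v = m"
  then have e: "e \<in> edges G" "v \<in> ends G e" by (auto simp: incident_def)
  obtain w g where or: "oriented e v w g" using oriented_exists[OF e] .
  then have sol: "solution_on (elen G e) (\<lambda>t. q (chart_from G v e t)) (\<lambda>t. u (chart_from G v e t)) g"
    by (simp add: oriented_def)
  have "0 \<le> g 0"
    by (rule solution_left_min[OF sol]) (use or uv m(2) chart_from_in_points[OF e] in \<open>simp add: oriented_def\<close>)
  then show "0 \<le> 1 * normal_deriv G u v e" using or by (simp add: oriented_def)
next
  fix e v w g s t
  assume *: "e \<in> edges G" "v \<in> ends G e" "oriented e v w g" "s \<in> {0..elen G e}"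
    "u (chart_from G v e s) = m" "g s = 0" "t \<in> {0..elen G e}"
  then have sol: "solution_on (elen G e) (\<lambda>t. q (chart_from G v e t)) (\<lambda>t. u (chart_from G v e t)) g"
    by (simp add: oriented_def)
  show "u (chart_from G v e t) = m"
    by (rule solution_min_unique[OF sol m(1) _ *(4-7)]) (use m(2) chart_from_in_points[OF *(1,2)] in simp)
qed (use m in auto)

text \<open>A negative minimum cannot lie on the boundary, where \<open>u\<close> is 0 or 1;
  elsewhere it would force \<open>u\<close> to be constant, against the same boundary
  values.\<close>

lemma u_nonneg:
  assumes "x \<in> gbar G"
  shows "0 \<le> u x"
proof -
  obtain p where p: "p \<in> gbar G" and min: "\<And>x. x \<in> gbar G \<Longrightarrow> u p \<le> u x"
    using continuous_attains_inf[OF compact_gbar gbar_nonempty continuous_u] by blast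
  have "0 \<le> u p"
  proof (rule ccontr)
    assume neg: "\<not> 0 \<le> u p"
    then have "p \<in> points G - boundary G" using gbar_cases[OF p] u_boundary[of p] by (auto simp: indicator_def split: if_splits)
    then have const: "u x = u p" if "x \<in> gbar G" for x
      using u_minimum_unique[of "u p" p x] neg min subsetD[OF points_subset_gbar] that by simp
    obtain y where "y \<in> boundary G" using boundary_nonempty by blast
    then have "u y = u p" "u y = indicator \<Omega> y" using const[of y] u_boundary[of y] boundary_subset_gbar by blast+
    then show False using neg by (cases "y \<in> \<Omega>") auto
  qed
  with min[OF assms] show ?thesis by simp
qed

text \<open>Otherwise \<open>u\<close> would be constantly 0, although it is 1 on the nonempty set
  \<open>\<Omega>\<close>.\<close>

lemma u_pos:
  assumes p: "p \<in> points G - boundary G"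
  shows "0 < u p"
proof (rule ccontr)
  assume "\<not> 0 < u p"
  then have "u p = 0" using u_nonneg[of p] p subsetD[OF points_subset_gbar, of p] by auto
  then have const: "u x = 0" if "x \<in> gbar G" for x
    using u_minimum_unique[of 0 p x] p that u_nonneg subsetD[OF points_subset_gbar] by simp
  obtain y where "y \<in> \<Omega>" using \<Omega>_nonempty by blast
  then have "y \<in> boundary G" "y \<in> gbar G" using \<Omega>_subset boundary_subset_gbar by blast+
  with \<open>y \<in> \<Omega>\<close> show False using u_boundary[of y] const[of y] by simp
qed

lemma oriented_nonneg:
  assumes "oriented e v w g" "e \<in> edges G" "t \<in> {0..elen G e}"
  shows "0 \<le> u (chart_from G v e t)"
  using u_nonneg chart_from_in_points[OF assms(2) oriented_left(1)[OF assms(1,2)] assms(3)] points_subset_gbar by blast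

lemma oriented_solution:
  "oriented e v w g \<Longrightarrow> solution_on (elen G e) (\<lambda>t. q (chart_from G v e t)) (\<lambda>t. u (chart_from G v e t)) g"
  by (simp add: oriented_def)

text \<open>Relies on \<open>u \<ge> 0\<close>, established above: it makes \<open>u\<close> convex
  on every edge, so a convex function with slope 0 at its maximum is constant there.\<close>

lemma u_maximum_unique:
  assumes m: "\<And>x. x \<in> points G \<Longrightarrow> u x \<le> m" and p: "p \<in> points G - boundary G" "u p = m"
    and x: "x \<in> gbar G"
  shows "u x = m"
proof (rule u_constant_if[OF _ _ _ _ p x, where \<sigma> = "- 1"])
  fix e v assume "e \<in> incident G v" and uv: "u v = m"
  then have e: "e \<in> edges G" "v \<in> ends G e" by (auto simp: incident_def)
  obtain w g where or: "oriented e v w g" using oriented_exists[OF e] .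
  have "w \<in> points G" using ends_in_verts[OF e(1) oriented_left(2)[OF or e(1)]] verts_subset_points by blast
  then have "g 0 \<le> 0"
    using solution_left_max[OF oriented_solution[OF or] oriented_nonneg[OF or e(1)]] or uv m[of w]
    by (simp add: oriented_def)
  then show "0 \<le> - 1 * normal_deriv G u v e" using or by (simp add: oriented_def)
next
  fix e v w g s t
  assume *: "e \<in> edges G" "v \<in> ends G e" "oriented e v w g" "s \<in> {0..elen G e}"
    "u (chart_from G v e s) = m" "g s = 0" "t \<in> {0..elen G e}"
  have "u (chart_from G v e t) = u (chart_from G v e s)"
    by (rule solution_max_unique[OF oriented_solution[OF *(3)] oriented_nonneg[OF *(3,1)] _ *(4,6,7)])
      (use m chart_from_in_points[OF *(1,2)] *(5) in auto)
  then show "u (chart_from G v e t) = m" using *(5) by simp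
qed (use m in auto)

lemma u_le_1:
  assumes "x \<in> gbar G"
  shows "u x \<le> 1"
proof -
  obtain p where p: "p \<in> gbar G" and max: "\<And>x. x \<in> gbar G \<Longrightarrow> u x \<le> u p"
    using continuous_attains_sup[OF compact_gbar gbar_nonempty continuous_u] by blast
  have "u p \<le> 1"
  proof (rule ccontr)
    assume big: "\<not> u p \<le> 1"
    then have "p \<in> points G - boundary G" using gbar_cases[OF p] u_boundary[of p] by (auto simp: indicator_def split: if_splits)
    then have const: "u x = u p" if "x \<in> gbar G" for x
      using u_maximum_unique[of "u p" p x] max subsetD[OF points_subset_gbar] that by simp
    obtain y where "y \<in> boundary G" using boundary_nonempty by blast
    then have "u y = u p" "u y = indicator \<Omega> y" using const[of y] u_boundary[of y] boundary_subset_gbar by blast+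
    then show False using big by (cases "y \<in> \<Omega>") auto
  qed
  with max[OF assms] show ?thesis by simp
qed

text \<open>Otherwise \<open>u\<close> would be constantly 1, although it is 0 at some boundary
  point outside \<open>\<Omega>\<close>.\<close>

lemma u_less_1:
  assumes p: "p \<in> points G - boundary G"
  shows "u p < 1"
proof (rule ccontr)
  assume "\<not> u p < 1"
  then have "u p = 1" using u_le_1[of p] p subsetD[OF points_subset_gbar, of p] by auto
  then have const: "u x = 1" if "x \<in> gbar G" for x
    using u_maximum_unique[of 1 p x] p that u_le_1 subsetD[OF points_subset_gbar] by simp
  obtain y where "y \<in> boundary G" "y \<notin> \<Omega>" using \<Omega>_proper \<Omega>_subset by blast
  moreover from this have "y \<in> gbar G" using boundary_subset_gbar by blast
  ultimately show False using u_boundary[of y] const[of y] by simp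
qed

end

section \<open>Fluxes\<close>

context harmonic_setting
begin

definition mass :: "'e \<Rightarrow> real" where
  "mass e = (LINT t:{0..elen G e}|lebesgue. \<bar>q (chart G e t)\<bar>)"

lemma mass_summable: "mass summable_on edges G"
  using potential unfolding admissible_potential_def graph_integrable_def mass_def by blast

lemma mass_nonneg: "0 \<le> mass e"
  unfolding mass_def set_lebesgue_integral_def by (intro integral_nonneg_AE AE_I2) auto

lemma mass_oriented:
  assumes or: "oriented e v w g" and e: "e \<in> edges G"
  shows "integral {0..elen G e} (\<lambda>t. q (chart_from G v e t)) = mass e"
proof -
  let ?L = "elen G e" and ?Q = "\<lambda>t. q (chart G e t)"
  have int: "(?Q has_integral mass e) {0..?L}"
  proof -
    have "mass e = integral {0..?L} (\<lambda>t. \<bar>?Q t\<bar>)"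
      unfolding mass_def by (intro set_lebesgue_integral_eq_integral(2) set_integrable_abs potential_edge_integrable e)
    also have "\<dots> = integral {0..?L} ?Q"
      by (rule Henstock_Kurzweil_Integration.integral_cong) (simp add: potential_nonneg chart_in_points[OF e])
    finally show ?thesis
      using set_lebesgue_integral_eq_integral(1)[OF potential_edge_integrable[OF e]]
      by (simp add: has_integral_integral)
  qed
  show ?thesis
  proof (cases rule: chart_from_cases[OF oriented_left(1)[OF or e] e])
    case 1
    then show ?thesis using int by (simp add: integral_unique)
  next
    case 2
    have "((\<lambda>t. ?Q (?L - t)) has_integral mass e) {0..?L}"
      using int by (intro has_integral_reflect_Icc) simp
    then show ?thesis using 2 by (simp add: integral_unique)
  qed
qed

text \<open>The boundary term of the integration by parts on \<open>e\<close>. The minus sign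
  appears because normal derivatives point into the edge.\<close>

definition flux :: "'e \<Rightarrow> ('a \<Rightarrow> real) \<Rightarrow> real" where
  "flux e \<psi> = - (\<Sum>v\<in>ends G e. \<psi> v * normal_deriv G u v e)"

lemma flux_oriented:
  assumes "oriented e v w g"
  shows "flux e \<psi> = \<psi> w * g (elen G e) - \<psi> v * g 0"
  using assms by (simp add: oriented_def flux_def)

text \<open>Kirchhoff's law makes the total flux insensitive to the values at finitely many inner vertices.\<close>

lemma has_sum_flux_modify:
  assumes D: "finite {v \<in> verts G. \<psi> v \<noteq> \<phi> v}"
    and bd: "\<And>v. v \<in> verts G \<Longrightarrow> v \<in> boundary G \<Longrightarrow> \<psi> v = \<phi> v"
    and c: "((\<lambda>e. flux e \<phi>) has_sum c) (edges G)"
  shows "((\<lambda>e. flux e \<psi>) has_sum c) (edges G)"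
proof -
  define D where "D = {v \<in> verts G. \<psi> v \<noteq> \<phi> v}"
  define K where "K = (\<Union>v\<in>D. incident G v)"
  define \<delta> where "\<delta> e = (\<Sum>v\<in>ends G e. (\<phi> v - \<psi> v) * normal_deriv G u v e)" for e
  have finD: "finite D" using D by (simp add: D_def)
  have finK: "finite K" unfolding K_def using finD finite_incident by (intro finite_UN_I) (auto simp: D_def)
  have Kedges: "K \<subseteq> edges G" by (auto simp: K_def incident_def)
  have finends: "finite (ends G e)" for e by (simp add: ends_def)
  have \<delta>D: "\<delta> e = (\<Sum>v\<in>D. if v \<in> ends G e then (\<phi> v - \<psi> v) * normal_deriv G u v e else 0)"
    if e: "e \<in> edges G" for e
  proof -
    have "\<delta> e = (\<Sum>v\<in>ends G e \<inter> D. (\<phi> v - \<psi> v) * normal_deriv G u v e)"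
      unfolding \<delta>_def using ends_in_verts[OF e] finends
      by (intro sum.mono_neutral_right) (auto simp: D_def)
    also have "\<dots> = (\<Sum>v\<in>D. if v \<in> ends G e then (\<phi> v - \<psi> v) * normal_deriv G u v e else 0)"
      by (subst Int_commute) (rule sum.inter_restrict[OF finD])
    finally show ?thesis .
  qed
  have "(\<Sum>e\<in>K. \<delta> e) = (\<Sum>e\<in>K. \<Sum>v\<in>D. if v \<in> ends G e then (\<phi> v - \<psi> v) * normal_deriv G u v e else 0)"
    by (rule sum.cong[OF refl]) (rule \<delta>D, use Kedges in blast)
  \<comment> \<open>After the interchange the inner sum is a multiple of the Kirchhoff sum at
    \<open>v\<close>, which is not a boundary vertex because the two functions agree on the
    boundary.\<close>
  also have "\<dots> = (\<Sum>v\<in>D. \<Sum>e\<in>K. if v \<in> ends G e then (\<phi> v - \<psi> v) * normal_deriv G u v e else 0)"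
    by (rule sum.swap)
  also have "\<dots> = (\<Sum>v\<in>D. 0)"
  proof (rule sum.cong[OF refl])
    fix v assume v: "v \<in> D"
    have "(\<Sum>e\<in>K. if v \<in> ends G e then (\<phi> v - \<psi> v) * normal_deriv G u v e else 0)
        = (\<Sum>e\<in>K \<inter> incident G v. (\<phi> v - \<psi> v) * normal_deriv G u v e)"
      using Kedges by (subst sum.inter_restrict[OF finK]) (auto simp: incident_def intro!: sum.cong)
    also have "K \<inter> incident G v = incident G v" using v by (auto simp: K_def)
    also have "(\<Sum>e\<in>incident G v. (\<phi> v - \<psi> v) * normal_deriv G u v e) = 0"
      using kirchhoff[of v] v bd[of v] by (auto simp: D_def sum_distrib_left[symmetric])
    finally show "(\<Sum>e\<in>K. if v \<in> ends G e then (\<phi> v - \<psi> v) * normal_deriv G u v e else 0) = 0" .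
  qed
  finally have "(\<Sum>e\<in>K. \<delta> e) = 0" by simp
  moreover have "\<delta> e = 0" if "e \<in> edges G - K" for e
  proof -
    have "v \<notin> D" if "v \<in> ends G e" for v
      using that \<open>e \<in> edges G - K\<close> by (auto simp: K_def incident_def)
    then have "\<phi> v = \<psi> v" if "v \<in> ends G e" for v
      using that ends_in_verts[of e v] \<open>e \<in> edges G - K\<close> by (auto simp: D_def)
    then show ?thesis by (simp add: \<delta>_def)
  qed
  ultimately have "(\<delta> has_sum 0) (edges G)"
    by (intro has_sum_finite_neutralI[OF finK Kedges]) auto
  from has_sum_add[OF c this] show ?thesis
    by (simp add: flux_def \<delta>_def sum_subtractf left_diff_distrib)
qed

section \<open>Test functions and their fluxes\<close>

lemma test_function_cont: "\<phi> \<in> test_algebra G \<Longrightarrow> continuous_on (gbar G) \<phi>"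
  by (simp add: test_algebra_def)

lemma test_function_chart_cont:
  assumes "\<phi> \<in> test_algebra G" "e \<in> edges G"
  shows "continuous_on {0..elen G e} (\<lambda>t. \<phi> (chart G e t))"
proof (rule continuous_on_compose2[OF test_function_cont[OF assms(1)] continuous_on_chart[OF assms(2)]])
  show "chart G e ` {0..elen G e} \<subseteq> gbar G"
    using chart_in_points[OF assms(2)] points_subset_gbar by blast
qed

lemma test_function_smooth:
  assumes "\<phi> \<in> test_algebra G" "e \<in> edges G" "0 < t" "t < elen G e"
  shows "(deriv ^^ n) (\<lambda>s. \<phi> (chart G e s)) differentiable (at t)"
  using assms by (simp add: test_algebra_def)

text \<open>Charts do not increase distances, so the neighbourhoods of the two end vertices where
  \<open>\<phi>\<close> is flat contain coordinate intervals of positive length. This is the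
  flatness that the integration by parts asks for.\<close>

lemma edge_integral_eq_flux:
  assumes \<phi>: "\<phi> \<in> test_algebra G" and e: "e \<in> edges G"
  shows "(LINT t:{0..elen G e}|lebesgue. u (chart G e t) * schroedinger G q \<phi> e t) = flux e \<phi>"
proof -
  let ?L = "elen G e" and ?P = "\<lambda>t. \<phi> (chart G e t)"
  note L = elen_pos[OF e]
  have near: "\<exists>\<delta>>0. \<forall>t. 0 < t \<and> t < ?L \<and> \<bar>t - s\<bar> < \<delta> \<longrightarrow> deriv ?P t = 0" if s: "s = 0 \<or> s = ?L" for s
  proof -
    have "chart G e s \<in> verts G" using ends_in_verts[OF e] s by (auto simp: ends_def)
    moreover have "\<forall>v\<in>verts G. \<exists>N. open N \<and> v \<in> N \<and>
        (\<forall>e\<in>edges G. \<forall>t\<in>{0<..<elen G e}. chart G e t \<in> N \<longrightarrow> deriv (\<lambda>s. \<phi> (chart G e s)) t = 0)"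
      using \<phi> by (simp add: test_algebra_def)
    ultimately obtain N where N: "open N" "chart G e s \<in> N"
      "\<forall>e\<in>edges G. \<forall>t\<in>{0<..<elen G e}. chart G e t \<in> N \<longrightarrow> deriv (\<lambda>s. \<phi> (chart G e s)) t = 0"
      by (elim ballE) auto
    from N(1,2) obtain \<delta> where \<delta>: "0 < \<delta>" "ball (chart G e s) \<delta> \<subseteq> N" by (auto simp: open_contains_ball)
    have "deriv ?P t = 0" if t: "0 < t" "t < ?L" "\<bar>t - s\<bar> < \<delta>" for t
    proof -
      have "dist (chart G e s) (chart G e t) < \<delta>"
        using dist_chart_le[OF e, of s t] t s L by auto
      then have "chart G e t \<in> N" using \<delta>(2) by auto
      then show ?thesis using N(3) e t by simp
    qed
    with \<delta>(1) show ?thesis by blast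
  qed
  obtain \<delta>1 where \<delta>1: "0 < \<delta>1" "\<forall>t. 0 < t \<and> t < ?L \<and> \<bar>t - 0\<bar> < \<delta>1 \<longrightarrow> deriv ?P t = 0"
    using near[of 0] by auto
  obtain \<delta>2 where \<delta>2: "0 < \<delta>2" "\<forall>t. 0 < t \<and> t < ?L \<and> \<bar>t - ?L\<bar> < \<delta>2 \<longrightarrow> deriv ?P t = 0"
    using near[of ?L] by auto
  obtain g where g: "solution_on ?L (\<lambda>t. q (chart G e t)) (\<lambda>t. u (chart G e t)) g" "abs_continuous_on 0 ?L g"
    "AE t in lebesgue. t \<in> {0<..<?L} \<longrightarrow> (g has_real_derivative q (chart G e t) * u (chart G e t)) (at t)"
    and nd: "normal_deriv G u (chart G e 0) e = g 0" "normal_deriv G u (chart G e ?L) e = - g ?L"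
    using edge_solution_chart[OF e] .
  have "(LINT t:{0..?L}|lebesgue. u (chart G e t) * (- (deriv ^^ 2) ?P t + q (chart G e t) * ?P t))
      = g ?L * ?P ?L - g 0 * ?P 0"
  proof (rule integral_by_parts_test_function[OF g potential_edge_integrable[OF e] test_function_chart_cont[OF \<phi> e]])
    show "(deriv ^^ n) ?P differentiable (at t)" if "0 < t" "t < ?L" for n t
      using test_function_smooth[OF \<phi> e that] .
    show "0 < min \<delta>1 \<delta>2" using \<delta>1(1) \<delta>2(1) by simp
    show "deriv ?P t = 0" if "0 < t" "t < ?L" "t < min \<delta>1 \<delta>2 \<or> ?L - min \<delta>1 \<delta>2 < t" for t
      using that(3) \<delta>1(2)[THEN spec[of _ t]] \<delta>2(2)[THEN spec[of _ t]] that(1,2) by auto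
  qed
  moreover have "chart G e 0 \<noteq> chart G e ?L" using chart_inj[OF e, of 0 ?L] L by auto
  ultimately show ?thesis by (simp add: schroedinger_def flux_def ends_def nd mult.commute)
qed

lemma test_function_edge_const:
  assumes \<phi>: "\<phi> \<in> test_algebra G" and e: "e \<in> edges G"
    and flat: "\<And>t. t \<in> {0<..<elen G e} \<Longrightarrow> deriv (\<lambda>s. \<phi> (chart G e s)) t = 0"
    and t: "t \<in> {0..elen G e}"
  shows "\<phi> (chart G e t) = \<phi> (chart G e 0)"
proof (rule DERIV_isconst2[OF elen_pos[OF e] test_function_chart_cont[OF \<phi> e]])
  fix x assume x: "0 < x" "x < elen G e"
  then show "((\<lambda>s. \<phi> (chart G e s)) has_real_derivative 0) (at x)"
    using test_function_smooth[OF \<phi> e x, of 0] flat[of x]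
    by (simp add: real_differentiable_def) (metis DERIV_imp_deriv)
qed (use t in auto)

end

text \<open>The data behind one value \<open>c\<close> of the Dirichlet-Neumann relation;
  \<open>F\<close> collects the finitely many edges on which \<open>\<phi>\<close> may vary.\<close>

locale dn_setting = harmonic_setting G q u \<Omega>
  for G :: "('a::metric_space, 'e) mgraph" and q u :: "'a \<Rightarrow> real" and \<Omega> :: "'a set" +
  fixes \<phi> :: "'a \<Rightarrow> real" and E :: "'a set" and c :: real and F :: "'e set"
  assumes \<phi>: "\<phi> \<in> test_algebra G" and \<phi>_1: "\<And>x. x \<in> E \<Longrightarrow> \<phi> x = 1"
    and \<phi>_0: "\<And>x. x \<in> boundary G - E \<Longrightarrow> \<phi> x = 0"
    and c: "c = graph_integral G (\<lambda>e t. u (chart G e t) * schroedinger G q \<phi> e t)"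
    and E_boundary: "E \<subseteq> boundary G" and E_nonempty: "E \<noteq> {}"
    and F: "finite F" "F \<subseteq> edges G"
    and flat: "\<And>e t. e \<in> edges G - F \<Longrightarrow> t \<in> {0<..<elen G e} \<Longrightarrow> deriv (\<lambda>s. \<phi> (chart G e s)) t = 0"
begin

lemma \<phi>_const: "e \<in> edges G - F \<Longrightarrow> t \<in> {0..elen G e} \<Longrightarrow> \<phi> (chart G e t) = \<phi> (chart G e 0)"
  by (rule test_function_edge_const[OF \<phi>]) (use flat in auto)

lemma \<phi>_const_ends:
  assumes "e \<in> edges G - F" "v \<in> ends G e" "w \<in> ends G e"
  shows "\<phi> v = \<phi> w"
  using \<phi>_const[OF assms(1), of "elen G e"] elen_pos[of e] assms by (auto simp: ends_def)

text \<open>Along a path \<open>\<phi>\<close> can change only on an edge of \<open>F\<close>, and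
  the path leaves such an edge through one of its ends. So the value at a vertex is the one at the
  base point \<open>y\<close> or at an end of an edge of \<open>F\<close>.\<close>

lemma finite_range_\<phi>: "finite (\<phi> ` verts G)"
proof -
  obtain y where "y \<in> points G"
    using gbar_nonempty unfolding gbar_def by (metis closure_empty ex_in_conv)
  define R where "R = insert (\<phi> y) (\<phi> ` (\<Union>e\<in>F. ends G e))"
  have "finite R" using F by (auto simp: R_def ends_def)
  \<comment> \<open>The first alternative covers the inner points of an edge of \<open>F\<close>,
    where the value of \<open>\<phi>\<close> is arbitrary.\<close>
  have reach: "(\<exists>e\<in>F. z \<in> chart G e ` {0..elen G e}) \<or> \<phi> z \<in> R" if "joined G p z r" "\<phi> p \<in> R" for p z r
    using that
  proof (induction rule: joined.induct)
    case (step p e s r t)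
    show ?case
    proof (cases "e \<in> F")
      case False
      then have e: "e \<in> edges G - F" using step.hyps by simp
      have "\<phi> (chart G e s) \<in> R"
      proof (rule ccontr)
        assume no: "\<phi> (chart G e s) \<notin> R"
        then obtain e' s' where e': "e' \<in> F" "s' \<in> {0..elen G e'}" "chart G e s = chart G e' s'"
          using step.IH[OF step.prems] by blast
        then have "chart G e s \<in> ends G e'"
          using common_point_is_end[of e e' s s'] e F(2) step.hyps by blast
        then show False using no e'(1) by (auto simp: R_def)
      qed
      moreover have "\<phi> (chart G e t) = \<phi> (chart G e s)"
        using \<phi>_const[OF e] step.hyps by metis
      ultimately show ?thesis by simp
    qed (use step.hyps in blast)
  qed simp
  have "\<phi> v \<in> R" if v: "v \<in> verts G" for v
  proof -
    obtain r where "joined G y v r"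
      using connected \<open>y \<in> points G\<close> v verts_subset_points unfolding graph_connected_def by blast
    then have "(\<exists>e\<in>F. v \<in> chart G e ` {0..elen G e}) \<or> \<phi> v \<in> R"
      by (rule reach) (simp add: R_def)
    moreover have "\<phi> v \<in> R" if "e \<in> F" "v \<in> chart G e ` {0..elen G e}" for e
    proof -
      obtain t where t: "t \<in> {0..elen G e}" "v = chart G e t" using \<open>v \<in> chart G e ` _\<close> by blast
      moreover have "e \<in> edges G" using \<open>e \<in> F\<close> F(2) by blast
      ultimately have "t = 0 \<or> t = elen G e" using chart_endpoint[of e t] v by simp
      then have "v \<in> ends G e" using t by (auto simp: ends_def)
      then show ?thesis using \<open>e \<in> F\<close> by (auto simp: R_def)
    qed
    ultimately show ?thesis by blast
  qed
  then show ?thesis using \<open>finite R\<close> by (meson finite_subset image_subsetI)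
qed

text \<open>The finitely many vertex values different from \<open>\<phi> x\<close> keep a positive
  distance from it, so continuity leaves only \<open>\<phi> x\<close> itself.\<close>

lemma \<phi>_near_ideal_point:
  assumes "x \<in> gbar G - points G"
  obtains r where "0 < r" "\<And>v. v \<in> verts G \<Longrightarrow> dist x v < r \<Longrightarrow> \<phi> v = \<phi> x"
proof -
  define A where "A = \<phi> ` verts G - {\<phi> x}"
  have "finite A" using finite_range_\<phi> by (simp add: A_def)
  then have "open (- A)" by (simp add: finite_imp_closed open_Compl)
  moreover have "\<phi> x \<in> - A" by (simp add: A_def)
  ultimately obtain \<epsilon> where \<epsilon>: "0 < \<epsilon>" "ball (\<phi> x) \<epsilon> \<subseteq> - A" by (auto simp: open_contains_ball)
  obtain r where r: "0 < r" "\<And>y. y \<in> gbar G \<Longrightarrow> dist y x < r \<Longrightarrow> dist (\<phi> y) (\<phi> x) < \<epsilon>"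
    using test_function_cont[OF \<phi>] assms \<epsilon>(1) unfolding continuous_on_iff by blast
  have "\<phi> v = \<phi> x" if v: "v \<in> verts G" "dist x v < r" for v
  proof (rule ccontr)
    assume "\<phi> v \<noteq> \<phi> x"
    then have "\<phi> v \<in> A" using v by (simp add: A_def)
    moreover have "v \<in> gbar G" using v verts_subset_points points_subset_gbar by blast
    then have "\<phi> v \<in> ball (\<phi> x) \<epsilon>" using r(2)[of v] v by (simp add: dist_commute)
    ultimately show False using \<epsilon>(2) by blast
  qed
  with r(1) that show thesis by blast
qed

text \<open>Off \<open>F\<close> the two end values of \<open>\<phi>\<close> agree, so the flux is
  this value times the integral of \<open>q * u\<close>, bounded by a multiple of
  \<open>mass e\<close>. Summability is essential: an infinite sum that does not converge would be 0
  by convention.\<close>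

lemma has_sum_flux_\<phi>: "((\<lambda>e. flux e \<phi>) has_sum c) (edges G)"
proof -
  obtain B where B: "\<And>x. x \<in> gbar G \<Longrightarrow> \<bar>\<phi> x\<bar> \<le> B"
    using compact_imp_bounded[OF compact_continuous_image[OF test_function_cont[OF \<phi>] compact_gbar]]
    by (auto simp: bounded_iff)
  have B0: "0 \<le> B" using B gbar_nonempty by (metis abs_ge_zero ex_in_conv order_trans)
  \<comment> \<open>On the finite set \<open>F\<close> the flux serves as its own bound.\<close>
  define b where "b e = (if e \<in> F then \<bar>flux e \<phi>\<bar> else 0) + B * mass e" for e
  have "(\<lambda>e. norm (flux e \<phi>)) summable_on edges G"
  proof (rule summable_on_comparison_test)
    have "((\<lambda>e. if e \<in> F then \<bar>flux e \<phi>\<bar> else 0) has_sum (\<Sum>e\<in>F. \<bar>flux e \<phi>\<bar>)) (edges G)"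
      using F by (intro has_sum_finite_neutralI) auto
    then show "b summable_on edges G"
      unfolding b_def by (intro summable_on_add summable_on_cmult_right mass_summable) (rule has_sum_imp_summable)
    fix e assume e: "e \<in> edges G"
    show "norm (flux e \<phi>) \<le> b e"
    proof (cases "e \<in> F")
      case True
      then show ?thesis using B0 mass_nonneg by (simp add: b_def)
    next
      case False
      have v: "chart G e 0 \<in> ends G e" by (simp add: ends_def)
      obtain w g where or: "oriented e (chart G e 0) w g" using oriented_exists[OF e v] .
      have "\<phi> w = \<phi> (chart G e 0)"
        using \<phi>_const_ends[of e w "chart G e 0"] oriented_left[OF or e] e False by simp
      then have fl: "flux e \<phi> = \<phi> (chart G e 0) * (g (elen G e) - g 0)"
        by (simp add: flux_oriented[OF or] right_diff_distrib)
      have "g (elen G e) - g 0 \<le> integral {0..elen G e} (\<lambda>t. q (chart_from G (chart G e 0) e t))"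
      proof (rule has_integral_le)
        show "((\<lambda>t. q (chart_from G (chart G e 0) e t) * u (chart_from G (chart G e 0) e t)) has_integral
            g (elen G e) - g 0) {0..elen G e}"
          using solution_deriv_increment[OF oriented_solution[OF or], of 0 "elen G e"] elen_pos[OF e] by simp
        show "((\<lambda>t. q (chart_from G (chart G e 0) e t)) has_integral
            integral {0..elen G e} (\<lambda>t. q (chart_from G (chart G e 0) e t))) {0..elen G e}"
          using solution_potential_integrable[OF oriented_solution[OF or], of 0 "elen G e"] by (simp add: has_integral_integral)
        fix t assume "t \<in> {0..elen G e}"
        then have "chart_from G (chart G e 0) e t \<in> points G" using chart_from_in_points[OF e v] by blast
        then show "q (chart_from G (chart G e 0) e t) * u (chart_from G (chart G e 0) e t) \<le> q (chart_from G (chart G e 0) e t)"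
          using u_le_1 potential_nonneg points_subset_gbar by (auto intro: mult_left_le)
      qed
      moreover have "g 0 \<le> g (elen G e)"
        using solution_deriv_mono[OF oriented_solution[OF or] oriented_nonneg[OF or e], of 0 "elen G e"] elen_pos[OF e] by simp
      ultimately have "\<bar>g (elen G e) - g 0\<bar> \<le> mass e" using mass_oriented[OF or e] by simp
      moreover have "chart G e 0 \<in> gbar G"
        using ends_in_verts[OF e v] verts_subset_points points_subset_gbar by blast
      ultimately have "\<bar>flux e \<phi>\<bar> \<le> B * mass e"
        unfolding fl abs_mult using B B0 by (intro mult_mono) auto
      then show ?thesis using False by (simp add: b_def)
    qed
  qed simp
  then have "(\<lambda>e. flux e \<phi>) summable_on edges G" by (rule abs_summable_summable)
  moreover have "c = infsum (\<lambda>e. flux e \<phi>) (edges G)"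
    unfolding c graph_integral_def by (intro infsum_cong edge_integral_eq_flux[OF \<phi>])
  ultimately show ?thesis by simp
qed

section \<open>Cutting off at a level of \<open>u\<close>\<close>

definition cutoff :: "real set \<Rightarrow> 'a \<Rightarrow> real" where
  "cutoff S v = (if u v \<in> S \<and> 1 / 2 < \<phi> v then 1 else 0)"

lemma cutoff_eq_\<phi>_boundary:
  assumes "\<And>x. x \<in> E \<Longrightarrow> u x \<in> S" "v \<in> boundary G"
  shows "cutoff S v = \<phi> v"
  using assms \<phi>_1[of v] \<phi>_0[of v] by (cases "v \<in> E") (auto simp: cutoff_def)

text \<open>At vertices near an ideal point of \<open>E\<close> both functions are 1, as
  \<open>u\<close> stays in the open set \<open>S\<close>; near any other ideal point both are 0.
  Hence the vertices where they differ accumulate at no ideal point.\<close>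

lemma has_sum_flux_cutoff:
  assumes S: "open S" "\<And>x. x \<in> E \<Longrightarrow> u x \<in> S"
  shows "((\<lambda>e. flux e (cutoff S)) has_sum c) (edges G)"
proof (rule has_sum_flux_modify[OF _ _ has_sum_flux_\<phi>])
  show "finite {v \<in> verts G. cutoff S v \<noteq> \<phi> v}"
  proof (rule finite_vert_set[OF compact_gbar])
    fix x assume x: "x \<in> gbar G - points G"
    then have xb: "x \<in> boundary G" by (simp add: boundary_def)
    obtain r where r: "0 < r" "\<And>v. v \<in> verts G \<Longrightarrow> dist x v < r \<Longrightarrow> \<phi> v = \<phi> x"
      using \<phi>_near_ideal_point[OF x] by blast
    show "\<exists>r>0. \<forall>v\<in>{v \<in> verts G. cutoff S v \<noteq> \<phi> v}. r \<le> dist x v"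
    proof (cases "x \<in> E")
      case True
      obtain \<epsilon> where \<epsilon>: "0 < \<epsilon>" "ball (u x) \<epsilon> \<subseteq> S"
        using S(1) S(2)[OF True] by (auto simp: open_contains_ball)
      obtain d where d: "0 < d" "\<And>y. y \<in> gbar G \<Longrightarrow> dist y x < d \<Longrightarrow> dist (u y) (u x) < \<epsilon>"
        using continuous_u x \<epsilon>(1) unfolding continuous_on_iff by blast
      have "cutoff S v = \<phi> v" if v: "v \<in> verts G" "dist x v < min r d" for v
      proof -
        have "v \<in> gbar G" using v(1) verts_subset_points points_subset_gbar by blast
        then have "u v \<in> ball (u x) \<epsilon>" using d(2)[of v] v(2) by (simp add: dist_commute)
        then have "u v \<in> S" using \<epsilon>(2) by blast
        moreover have "\<phi> v = 1" using r(2)[of v] v \<phi>_1[OF True] by simp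
        ultimately show ?thesis by (simp add: cutoff_def)
      qed
      then have "min r d \<le> dist x v" if "v \<in> verts G" "cutoff S v \<noteq> \<phi> v" for v
        using that by (meson not_le)
      moreover have "0 < min r d" using r(1) d(1) by simp
      ultimately show ?thesis by blast
    next
      case False
      then have "\<phi> x = 0" using \<phi>_0 xb by simp
      then have "cutoff S v = \<phi> v" if "v \<in> verts G" "dist x v < r" for v
        using r(2)[OF that] by (simp add: cutoff_def)
      then have "r \<le> dist x v" if "v \<in> verts G" "cutoff S v \<noteq> \<phi> v" for v
        using that by (meson not_le)
      with r(1) show ?thesis by blast
    qed
  qed auto
qed (use cutoff_eq_\<phi>_boundary S(2) in simp)

text \<open>An edge with different end values is oriented from the value 1 to the value 0, so that
  only the derivative at its left end remains.\<close>

lemma flux_cutoff_cases: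
  assumes e: "e \<in> edges G"
  obtains (outside) "flux e (cutoff S) = 0" "\<And>v. v \<in> ends G e \<Longrightarrow> cutoff S v = 0"
  | (inside) v w g where "oriented e v w g" "cutoff S v = 1" "cutoff S w = 1"
      "flux e (cutoff S) = g (elen G e) - g 0"
  | (crossing) v w g where "oriented e v w g" "cutoff S v = 1" "cutoff S w = 0"
      "flux e (cutoff S) = - g 0"
proof -
  have "chart G e 0 \<in> ends G e" by (simp add: ends_def)
  then obtain v w g where or: "oriented e v w g" using oriented_exists[OF e] by blast
  have 01: "cutoff S x = 0 \<or> cutoff S x = 1" for x by (simp add: cutoff_def)
  obtain w' g' where or': "oriented e w w' g'" using oriented_exists[OF e oriented_left(2)[OF or e]] .
  have "w' = v" using or or' unfolding oriented_def by (metis doubleton_eq_iff)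
  show thesis
  proof (cases "cutoff S v = 1")
    case True
    with 01[of w] flux_oriented[OF or, of "cutoff S"] or that(2,3) show thesis by auto
  next
    case v0: False
    show thesis
    proof (cases "cutoff S w = 1")
      case True
      with 01[of v] flux_oriented[OF or', of "cutoff S"] or' that(3) v0 \<open>w' = v\<close> show thesis by auto
    next
      case False
      then have "cutoff S v = 0" "cutoff S w = 0" using 01 v0 by metis+
      then show thesis
        using that(1) flux_oriented[OF or, of "cutoff S"] or unfolding oriented_def by auto
    qed
  qed
qed

text \<open>Off \<open>F\<close> the two ends share the value of \<open>\<phi>\<close>, so only
  \<open>u\<close> can switch the cutoff off.\<close>

lemma crossing_cases:
  assumes "oriented e v w g" "e \<in> edges G" "cutoff S v = 1" "cutoff S w = 0"
  shows "u v \<in> S" and "u w \<notin> S \<or> e \<in> F"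
proof -
  show "u v \<in> S" using assms(3) by (simp add: cutoff_def split: if_splits)
  show "u w \<notin> S \<or> e \<in> F"
  proof (rule ccontr)
    assume no: "\<not> (u w \<notin> S \<or> e \<in> F)"
    then have "\<phi> v = \<phi> w" using \<phi>_const_ends[of e v w] oriented_left[OF assms(1,2)] assms(2) by simp
    then show False using no assms(3,4) by (simp add: cutoff_def split: if_splits)
  qed
qed

text \<open>Without crossings the value 1 spreads from one vertex to all by connectedness. If the
  chosen point of \<open>E\<close> is ideal, \<open>near\<close> supplies the first vertex: it
  passes from a point of an edge close to the ideal point to an end of that edge.\<close>

lemma cutoff_all_1:
  assumes S: "open S" "\<And>x. x \<in> E \<Longrightarrow> u x \<in> S"
    and near: "\<And>e t. e \<in> edges G \<Longrightarrow> t \<in> {0..elen G e} \<Longrightarrow> u (chart G e t) \<in> S \<Longrightarrow> \<exists>v\<in>ends G e. u v \<in> S"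
    and no_crossing: "\<And>e v w g. e \<in> edges G \<Longrightarrow> oriented e v w g \<Longrightarrow> cutoff S v = 1 \<Longrightarrow> cutoff S w = 1"
    and e: "e \<in> edges G" and v: "v \<in> ends G e"
  shows "cutoff S v = 1"
proof -
  have spread: "cutoff S w = 1" if "e \<in> edges G" "v \<in> ends G e" "w \<in> ends G e" "cutoff S v = 1" for e v w
  proof -
    obtain w' g where or: "oriented e v w' g" using oriented_exists[OF \<open>e \<in> edges G\<close> \<open>v \<in> ends G e\<close>] .
    then have "w = v \<or> w = w'" using \<open>w \<in> ends G e\<close> by (auto simp: oriented_def)
    then show ?thesis using no_crossing[OF \<open>e \<in> edges G\<close> or] that by auto
  qed
  obtain x where x: "x \<in> E" using E_nonempty by blast
  have "\<exists>v\<in>verts G. cutoff S v = 1"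
  proof (cases "x \<in> verts G")
    case True
    then show ?thesis using S(2)[OF x] \<phi>_1[OF x] by (intro bexI[of _ x]) (simp_all add: cutoff_def)
  next
    case False
    then have xi: "x \<in> gbar G - points G" using x E_boundary by (auto simp: boundary_def)
    obtain \<epsilon> where \<epsilon>: "0 < \<epsilon>" "ball (u x) \<epsilon> \<subseteq> S"
      using S(1) S(2)[OF x] by (auto simp: open_contains_ball)
    obtain d1 where d1: "0 < d1" "\<And>y. y \<in> gbar G \<Longrightarrow> dist y x < d1 \<Longrightarrow> dist (u y) (u x) < \<epsilon>"
      using continuous_u xi \<epsilon>(1) unfolding continuous_on_iff by blast
    obtain d2 where d2: "0 < d2" "\<And>y. y \<in> gbar G \<Longrightarrow> dist y x < d2 \<Longrightarrow> dist (\<phi> y) (\<phi> x) < 1 / 2"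
      using test_function_cont[OF \<phi>] xi unfolding continuous_on_iff by (metis DiffD1 half_gt_zero zero_less_one)
    \<comment> \<open>Finitely many closed edges keep away from the ideal point \<open>x\<close>, so
      a point of the graph close to \<open>x\<close> lies on an edge where \<open>\<phi>\<close> is
      constant.\<close>
    define C where "C = (\<Union>e\<in>F. chart G e ` {0..elen G e})"
    have "closed C" unfolding C_def by (intro closed_UN ballI F(1) closed_chart_image subsetD[OF F(2)])
    moreover have "C \<subseteq> points G" unfolding C_def using F(2) chart_in_points by fast
    then have "x \<in> - C" using xi by blast
    ultimately obtain d3 where d3: "0 < d3" "ball x d3 \<subseteq> - C"
      using open_contains_ball[of "- C"] by (auto simp: open_Compl)
    have "0 < min d1 (min d2 d3)" using d1 d2 d3 by simp
    then obtain p where p: "p \<in> points G" "dist p x < min d1 (min d2 d3)"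
      using xi unfolding gbar_def by (meson DiffD1 closure_approachable)
    have pg: "p \<in> gbar G" using p points_subset_gbar by blast
    have "u p \<in> ball (u x) \<epsilon>" using d1(2)[OF pg] p by (simp add: dist_commute)
    then have "u p \<in> S" using \<epsilon>(2) by blast
    have "dist (\<phi> p) (\<phi> x) < 1 / 2" using d2(2)[OF pg] p by simp
    then have \<phi>p: "1 / 2 < \<phi> p" using \<phi>_1[OF x] unfolding dist_real_def by linarith
    have "p \<in> ball x d3" using p by (simp add: dist_commute)
    then have "p \<notin> C" using d3(2) by blast
    obtain e t where e: "e \<in> edges G" "t \<in> {0..elen G e}" "p = chart G e t" using point_on_edge[OF p(1)] .
    then have "e \<notin> F" using \<open>p \<notin> C\<close> by (auto simp: C_def)
    obtain v where v: "v \<in> ends G e" "u v \<in> S" using near[OF e(1,2)] \<open>u p \<in> S\<close> e(3) by blast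
    have "\<phi> v = \<phi> (chart G e 0)" using \<phi>_const_ends[of e v "chart G e 0"] v e(1) \<open>e \<notin> F\<close> by (simp add: ends_def)
    also have "\<dots> = \<phi> p" using \<phi>_const[of e t] e \<open>e \<notin> F\<close> by simp
    finally show ?thesis using v \<phi>p ends_in_verts[OF e(1)] by (auto simp: cutoff_def)
  qed
  then obtain v0 where v0: "v0 \<in> verts G" "cutoff S v0 = 1" by blast
  then obtain e0 where e0: "e0 \<in> edges G" "v0 \<in> ends G e0" using vert_incident by (auto simp: incident_def)
  define T where "T = {e \<in> edges G. \<forall>v\<in>ends G e. cutoff S v = 1}"
  have "T = edges G"
  proof (rule edges_adjacency_connected)
    show "T \<subseteq> edges G" by (auto simp: T_def)
    have "e0 \<in> T" using spread[OF e0] v0(2) e0(1) by (simp add: T_def)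
    then show "T \<noteq> {}" by blast
    fix e e' v assume *: "e \<in> T" "e' \<in> edges G" "e \<noteq> e'" "v \<in> ends G e" "v \<in> ends G e'"
    then have "cutoff S v = 1" by (simp add: T_def)
    then show "e' \<in> T" using spread[OF *(2,5)] *(2) by (simp add: T_def)
  qed
  then have "e \<in> T" using e by simp
  then show ?thesis using v by (simp add: T_def)
qed

end

section \<open>Signs of the fluxes and of their sum\<close>

context dn_setting
begin

lemma oriented_ends:
  assumes "oriented e v w g"
  shows "u (chart_from G v e 0) = u v" "u (chart_from G v e (elen G e)) = u w"
  using assms by (simp_all add: oriented_def)

lemma oriented_le_max:
  assumes or: "oriented e v w g" and e: "e \<in> edges G" and t: "t \<in> {0..elen G e}"
  shows "u (chart_from G v e t) \<le> max (u v) (u w)"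
  using solution_le_max[OF oriented_solution[OF or] oriented_nonneg[OF or e], of 0 t "elen G e"] t
  by (simp add: oriented_ends[OF or])

lemma edge_le_max:
  assumes e: "e \<in> edges G" and x: "x \<in> chart G e ` {0..elen G e}"
  obtains v where "v \<in> ends G e" "u x \<le> u v"
proof -
  have v: "chart G e 0 \<in> ends G e" by (simp add: ends_def)
  obtain w g where or: "oriented e (chart G e 0) w g" using oriented_exists[OF e v] .
  have "x \<in> chart_from G (chart G e 0) e ` {0..elen G e}" using x chart_from_image[OF v e] by simp
  then obtain t where "t \<in> {0..elen G e}" "x = chart_from G (chart G e 0) e t" by blast
  with oriented_le_max[OF or e] have "u x \<le> u (chart G e 0) \<or> u x \<le> u w" by (simp add: le_max_iff_disj)
  then show thesis using that v oriented_left(2)[OF or e] by blast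
qed

lemma ends_in_points: "e \<in> edges G \<Longrightarrow> v \<in> ends G e \<Longrightarrow> v \<in> points G"
  using ends_in_verts verts_subset_points by blast

lemma oriented_midpoint:
  assumes "oriented e v w g" "e \<in> edges G"
  shows "0 < elen G e / 2" "elen G e / 2 < elen G e"
    "0 < u (chart_from G v e (elen G e / 2))" "u (chart_from G v e (elen G e / 2)) < 1"
proof -
  show *: "0 < elen G e / 2" "elen G e / 2 < elen G e" using elen_pos[OF assms(2)] by auto
  have "chart_from G v e (elen G e / 2) \<in> points G - boundary G"
    by (rule chart_from_interior_not_boundary[OF assms(2) oriented_left(1)[OF assms] *])
  then show "0 < u (chart_from G v e (elen G e / 2))" "u (chart_from G v e (elen G e / 2)) < 1"
    using u_pos u_less_1 by blast+
qed

lemma edges_nonempty: "edges G \<noteq> {}"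
proof -
  obtain y where "y \<in> points G"
    using gbar_nonempty unfolding gbar_def by (metis closure_empty ex_in_conv)
  then show ?thesis using point_on_edge by blast
qed

text \<open>If \<open>c \<le> 0\<close>, all fluxes of the cutoff, being nonnegative, vanish. Then
  nothing crosses, the cutoff is 1 at every vertex, and the single edge \<open>e0\<close> gives a
  contradiction.\<close>

lemma dn_pos:
  assumes E: "E \<subseteq> \<Omega>"
  shows "0 < c"
proof (rule ccontr)
  assume neg: "\<not> 0 < c"
  obtain e0 where e0: "e0 \<in> edges G" using edges_nonempty by blast
  \<comment> \<open>The values below 1 at the ends of the exceptional edges and of the test edge
    \<open>e0\<close>. Beyond their maximum \<open>m\<close>, the only value left at these ends is
    1.\<close>
  define A where "A = {x \<in> u ` (\<Union>e\<in>insert e0 F. ends G e). x < 1}"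
  have finA: "finite A" using F by (auto simp: A_def ends_def)
  define m where "m = Max (insert 0 A)"
  have m: "m < 1" "\<And>x. x \<in> A \<Longrightarrow> x \<le> m"
    using finA by (auto simp: m_def A_def)
  have u_end_1: "u v = 1" if "e = e0 \<or> e \<in> F" "v \<in> ends G e" "m < u v" for e v
  proof -
    have "e \<in> edges G" using that(1) e0 F by blast
    then have "u v \<le> 1" using u_le_1 ends_in_points that points_subset_gbar by blast
    moreover have "\<not> u v < 1"
    proof
      assume "u v < 1"
      then have "u v \<in> A" using that by (auto simp: A_def)
      then show False using m(2) that(3) by fastforce
    qed
    ultimately show ?thesis by simp
  qed
  let ?S = "{m<..} :: real set"
  have ES: "u x \<in> ?S" if "x \<in> E" for x
  proof -
    have "x \<in> \<Omega>" "x \<in> boundary G" using that E E_boundary by blast+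
    then show ?thesis using u_boundary[of x] m(1) by simp
  qed
  have S: "open ?S" by simp
  note sum = has_sum_flux_cutoff[OF S ES]
  \<comment> \<open>If \<open>u w < u v\<close>, convexity forces a negative slope; if both values
    are 1, then \<open>g 0 \<ge> 0\<close> would give \<open>u \<ge> 1\<close> at the midpoint. The
    second alternative of the last hypothesis is meant for \<open>e0\<close>.\<close>
  have sink: "g 0 < 0" if e: "e \<in> edges G" and or: "oriented e v w g" and v: "cutoff ?S v = 1"
    and w: "cutoff ?S w = 0 \<or> u v = 1 \<and> u w = 1 \<and> g 0 = g (elen G e)" for e v w g
  proof (rule ccontr)
    assume g0: "\<not> g 0 < 0"
    have le: "u w \<le> u v \<and> (u w = u v \<longrightarrow> u v = 1)"
      using w
    proof
      assume w0: "cutoff ?S w = 0"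
      have "u w \<le> 1" using u_le_1 ends_in_points[OF e oriented_left(2)[OF or e]] points_subset_gbar by blast
      then show ?thesis
        using crossing_cases[OF or e v w0] u_end_1[of e v] oriented_left(1)[OF or e] by auto
    qed simp
    have "\<not> u w < u v"
      using solution_left_strict_max[OF oriented_solution[OF or] oriented_nonneg[OF or e]] g0
      by (auto simp: oriented_ends[OF or])
    then have "u w = u v" "u v = 1" "0 \<le> g 0" using le g0 by auto
    then have "1 + g 0 * (elen G e / 2 - 0) \<le> u (chart_from G v e (elen G e / 2))"
      using solution_above_left_tangent[OF oriented_solution[OF or] oriented_nonneg[OF or e], of 0 "elen G e / 2"]
        oriented_midpoint(1,2)[OF or e] by (simp add: oriented_ends[OF or])
    moreover have "0 \<le> g 0 * (elen G e / 2 - 0)" using \<open>0 \<le> g 0\<close> oriented_midpoint(1)[OF or e] by simp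
    ultimately show False using oriented_midpoint(4)[OF or e] by linarith
  qed
  have nonneg: "0 \<le> flux e (cutoff ?S)" if e: "e \<in> edges G" for e
  proof (cases rule: flux_cutoff_cases[OF e, of ?S, case_names outside inside crossing])
    case (inside v w g)
    then show ?thesis
      using solution_deriv_mono[OF oriented_solution[OF inside(1)] oriented_nonneg[OF inside(1) e], of 0 "elen G e"] elen_pos[OF e]
      by simp
  next
    case (crossing v w g)
    then show ?thesis using sink[OF e crossing(1,2)] by simp
  qed simp
  \<comment> \<open>A single nonnegative term is at most the total \<open>c \<le> 0\<close>.\<close>
  have zero: "flux e (cutoff ?S) = 0" if e: "e \<in> edges G" for e
    using finite_sum_le_has_sum[OF sum, of "{e}"] nonneg e neg by force
  have all1: "cutoff ?S v = 1" if "e \<in> edges G" "v \<in> ends G e" for e v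
  proof (rule cutoff_all_1[OF S ES _ _ that])
    fix e t assume *: "e \<in> edges G" "t \<in> {0..elen G e}" "u (chart G e t) \<in> ?S"
    obtain v where "v \<in> ends G e" "u (chart G e t) \<le> u v" using edge_le_max[OF *(1) imageI[OF *(2)]] .
    with *(3) show "\<exists>v\<in>ends G e. u v \<in> ?S" by (auto intro!: bexI[of _ v])
  next
    fix e v w g assume *: "e \<in> edges G" "oriented e v w g" "cutoff ?S v = 1"
    show "cutoff ?S w = 1"
    proof (rule ccontr)
      assume "cutoff ?S w \<noteq> 1"
      then have w0: "cutoff ?S w = 0" by (simp add: cutoff_def split: if_splits)
      then have "flux e (cutoff ?S) = - g 0" using flux_oriented[OF *(2)] *(3) by simp
      then show False using sink[OF * disjI1[OF w0]] zero[OF *(1)] by simp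
    qed
  qed
  have v: "chart G e0 0 \<in> ends G e0" by (simp add: ends_def)
  obtain w g where or: "oriented e0 (chart G e0 0) w g" using oriented_exists[OF e0 v] .
  note w = oriented_left(2)[OF or e0]
  have c1: "cutoff ?S (chart G e0 0) = 1" "cutoff ?S w = 1" using all1 e0 v w by auto
  then have "m < u (chart G e0 0)" "m < u w" by (auto simp: cutoff_def split: if_splits)
  then have u1: "u (chart G e0 0) = 1" "u w = 1" using u_end_1 v w by auto
  \<comment> \<open>Equal end slopes make \<open>sink\<close> applicable to \<open>e0\<close>; the
    negative slope at the right end then contradicts the equal end values by convexity.\<close>
  have geq: "g 0 = g (elen G e0)" using zero[OF e0] flux_oriented[OF or, of "cutoff ?S"] c1 by simp
  then have "g 0 < 0" using sink[OF e0 or c1(1)] u1 by simp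
  moreover have "u w \<le> u (chart G e0 0) + g (elen G e0) * (elen G e0 - 0)"
    using solution_below_right_tangent[OF oriented_solution[OF or] oriented_nonneg[OF or e0], of 0 "elen G e0"] elen_pos[OF e0]
    by (simp add: oriented_ends[OF or])
  moreover have "g (elen G e0) * (elen G e0 - 0) < 0"
    using \<open>g 0 < 0\<close> geq elen_pos[OF e0] by (simp add: mult_neg_pos)
  ultimately show False using u1 by linarith
qed

text \<open>The least positive value of \<open>u\<close> at the ends of the exceptional edges,
  capped by 1/2 so as to lie below the value 1 taken on \<open>\<Omega>\<close>.\<close>

lemma level_exists:
  obtains \<epsilon> where "0 < \<epsilon>" "\<epsilon> < 1" "\<And>e v. e \<in> F \<Longrightarrow> v \<in> ends G e \<Longrightarrow> u v < \<epsilon> \<Longrightarrow> u v = 0"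
proof -
  define A where "A = {x \<in> u ` (\<Union>e\<in>F. ends G e). 0 < x}"
  have finA: "finite A" using F by (auto simp: A_def ends_def)
  define m where "m = Min (insert (1 / 2) A)"
  have m: "0 < m" "m < 1" "\<And>x. x \<in> A \<Longrightarrow> m \<le> x"
    using finA by (auto simp: m_def A_def min_less_iff_disj intro: le_less_trans[OF Min_le])
  have "u v = 0" if "e \<in> F" "v \<in> ends G e" "u v < m" for e v
  proof -
    have "0 \<le> u v" using u_nonneg ends_in_points[of e v] that F points_subset_gbar by blast
    moreover have "\<not> 0 < u v"
    proof
      assume "0 < u v"
      then have "u v \<in> A" using that by (auto simp: A_def)
      then show False using m(3) that(3) by fastforce
    qed
    ultimately show ?thesis by simp
  qed
  with m(1,2) that show thesis by blast
qed

lemma u_zero_on_E: "E \<subseteq> boundary G - \<Omega> \<Longrightarrow> x \<in> E \<Longrightarrow> u x = 0"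
  using u_boundary[of x] by (auto simp: subset_eq)

text \<open>An edge with both ends below the level contributes at most
  \<open>\<epsilon> * mass e\<close> through the integral of \<open>q * u\<close>; a crossing edge
  does so by the outflow bound, or because \<open>u\<close> has its minimum at the inner end.
  Summing gives \<open>c \<le> \<epsilon> * M\<close> for all small
  \<open>\<epsilon>\<close>.\<close>

lemma dn_nonpos:
  assumes E: "E \<subseteq> boundary G - \<Omega>"
  shows "c \<le> 0"
proof -
  obtain \<epsilon>0 where \<epsilon>0: "0 < \<epsilon>0" "\<And>e v. e \<in> F \<Longrightarrow> v \<in> ends G e \<Longrightarrow> u v < \<epsilon>0 \<Longrightarrow> u v = 0"
    using level_exists by metis
  define M where "M = infsum mass (edges G)"
  have bound: "c \<le> \<epsilon> * M" if \<epsilon>: "0 < \<epsilon>" "\<epsilon> \<le> \<epsilon>0" for \<epsilon>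
  proof -
    let ?S = "{..<\<epsilon>} :: real set"
    have S: "open ?S" by simp
    have ES: "u x \<in> ?S" if "x \<in> E" for x using u_zero_on_E[OF E that] \<epsilon>(1) by simp
    have "((\<lambda>e. \<epsilon> * mass e) has_sum \<epsilon> * M) (edges G)"
      unfolding M_def by (intro has_sum_cmult_right has_sum_infsum mass_summable)
    with has_sum_flux_cutoff[OF S ES] show ?thesis
    proof (rule has_sum_mono)
      fix e assume e: "e \<in> edges G"
      have m0: "0 \<le> \<epsilon> * mass e" using \<epsilon>(1) mass_nonneg by simp
      show "flux e (cutoff ?S) \<le> \<epsilon> * mass e"
      proof (cases rule: flux_cutoff_cases[OF e, of ?S, case_names outside inside crossing])
        case outside
        then show ?thesis using m0 by simp
      next
        case (inside v w g)
        note sol = oriented_solution[OF inside(1)]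
        have uvw: "u v < \<epsilon>" "u w < \<epsilon>" using inside(2,3) by (auto simp: cutoff_def split: if_splits)
        have "g (elen G e) - g 0 \<le> \<epsilon> * mass e"
        proof (rule has_integral_le)
          show "((\<lambda>t. q (chart_from G v e t) * u (chart_from G v e t)) has_integral g (elen G e) - g 0) {0..elen G e}"
            using solution_deriv_increment[OF sol, of 0 "elen G e"] elen_pos[OF e] by simp
          show "((\<lambda>t. \<epsilon> * q (chart_from G v e t)) has_integral \<epsilon> * mass e) {0..elen G e}"
            unfolding mass_oriented[OF inside(1) e, symmetric]
            by (intro has_integral_mult_right integrable_integral solution_potential_integrable[OF sol]) auto
          fix t assume t: "t \<in> {0..elen G e}"
          have "u (chart_from G v e t) \<le> \<epsilon>" using oriented_le_max[OF inside(1) e t] uvw by simp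
          then show "q (chart_from G v e t) * u (chart_from G v e t) \<le> \<epsilon> * q (chart_from G v e t)"
            using solution_potential_nonneg[OF sol t] mult_left_mono by (subst mult.commute[of \<epsilon>]) blast
        qed
        with inside(4) show ?thesis by simp
      next
        case (crossing v w g)
        note sol = oriented_solution[OF crossing(1)] and ends = oriented_ends[OF crossing(1)]
        note nn = oriented_nonneg[OF crossing(1) e]
        have uv: "u v < \<epsilon>" and cases: "\<epsilon> \<le> u w \<or> e \<in> F"
          using crossing_cases[OF crossing(1) e crossing(2,3)] by auto
        have "- g 0 \<le> \<epsilon> * mass e"
        proof (cases "\<epsilon> \<le> u w")
          case True
          then have "- g 0 \<le> u v * mass e"
            using solution_outflow_bound[OF sol nn] uv mass_oriented[OF crossing(1) e] ends by simp
          also have "\<dots> \<le> \<epsilon> * mass e" using uv mass_nonneg by (intro mult_right_mono) auto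
          finally show ?thesis .
        next
          case False
          \<comment> \<open>On an exceptional edge an end below the level is a zero of
            \<open>u\<close>, hence a minimum, and \<open>u\<close> cannot decrease from
            there.\<close>
          then have "u v = 0" using cases \<epsilon>0(2) uv \<epsilon>(2) oriented_left(1)[OF crossing(1) e] by auto
          then have "0 \<le> g 0" using solution_left_min[OF sol] nn ends by simp
          with m0 show ?thesis by simp
        qed
        with crossing(4) show ?thesis by simp
      qed
    qed
  qed
  have "0 \<le> M" unfolding M_def by (intro infsum_nonneg mass_nonneg)
  show "c \<le> 0"
  proof (rule ccontr)
    assume "\<not> c \<le> 0"
    \<comment> \<open>This choice gives \<open>\<epsilon> * M < c\<close>, also for
      \<open>M = 0\<close>.\<close>
    define \<epsilon> where "\<epsilon> = min \<epsilon>0 (c / (2 * (M + 1)))"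
    have "0 < \<epsilon>" "\<epsilon> \<le> \<epsilon>0" using \<epsilon>0(1) \<open>0 \<le> M\<close> \<open>\<not> c \<le> 0\<close> by (auto simp: \<epsilon>_def)
    then have "c \<le> \<epsilon> * M" by (rule bound)
    also have "\<dots> \<le> c / (2 * (M + 1)) * M" using \<open>0 \<le> M\<close> by (intro mult_right_mono) (auto simp: \<epsilon>_def)
    also have "\<dots> < c"
    proof -
      have "0 \<le> M * c" "0 < c" using \<open>0 \<le> M\<close> \<open>\<not> c \<le> 0\<close> by auto
      then have "0 < M * c + c * 2" by linarith
      then show ?thesis using \<open>0 \<le> M\<close> by (simp add: field_simps)
    qed
    finally show False by simp
  qed
qed

text \<open>If \<open>c \<ge> 0\<close>, all fluxes of the cutoff, being nonpositive, vanish. The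
  cutoff is then 1 at every vertex, so \<open>u \<le> \<epsilon> < 1\<close> on the whole
  completion, against \<open>u = 1\<close> on \<open>\<Omega>\<close>.\<close>

lemma dn_neg:
  assumes E: "E \<subseteq> boundary G - \<Omega>"
    and N: "openin (top_of_set (gbar G)) N" "boundary G \<subseteq> N" "\<And>x. x \<in> N \<Longrightarrow> x \<in> points G \<Longrightarrow> q x = 0"
  shows "c < 0"
proof (rule ccontr)
  assume neg: "\<not> c < 0"
  obtain \<epsilon>0 where \<epsilon>0: "0 < \<epsilon>0" "\<epsilon>0 < 1" "\<And>e v. e \<in> F \<Longrightarrow> v \<in> ends G e \<Longrightarrow> u v < \<epsilon>0 \<Longrightarrow> u v = 0"
    using level_exists by metis
  \<comment> \<open>Outside \<open>N\<close> there are no boundary points, so \<open>u\<close> is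
    positive there and, by compactness, bounded below. Hence \<open>q\<close> vanishes at all points
    of the graph where \<open>u < \<epsilon>1\<close>.\<close>
  obtain \<epsilon>1 where \<epsilon>1: "0 < \<epsilon>1" "\<And>x. x \<in> gbar G - N \<Longrightarrow> \<epsilon>1 \<le> u x"
  proof (cases "gbar G - N = {}")
    case True
    then show thesis using that[of 1] by auto
  next
    case False
    have "compact (gbar G - N)"
    proof -
      obtain T where T: "open T" "N = gbar G \<inter> T" using N(1) by (auto simp: openin_open)
      then have "gbar G - N = gbar G - T" by blast
      then show ?thesis using compact_diff[OF compact_gbar T(1)] by simp
    qed
    moreover have "continuous_on (gbar G - N) u" by (rule continuous_on_subset[OF continuous_u]) blast
    ultimately obtain x where x: "x \<in> gbar G - N" "\<And>y. y \<in> gbar G - N \<Longrightarrow> u x \<le> u y"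
      using continuous_attains_inf[OF _ False] by metis
    have "x \<in> points G - boundary G" using x(1) N(2) gbar_cases by blast
    then show thesis using that[of "u x"] u_pos x(2) by blast
  qed
  define \<epsilon> where "\<epsilon> = min \<epsilon>0 \<epsilon>1"
  have \<epsilon>: "0 < \<epsilon>" "\<epsilon> < 1" "\<epsilon> \<le> \<epsilon>0" "\<epsilon> \<le> \<epsilon>1" using \<epsilon>0 \<epsilon>1 by (auto simp: \<epsilon>_def)
  have free: "q x = 0" if "x \<in> points G" "u x < \<epsilon>" for x
  proof (rule N(3))
    have "x \<in> gbar G" using that(1) points_subset_gbar by blast
    then show "x \<in> N" using \<epsilon>1(2)[of x] that(2) \<epsilon>(4) by force
  qed (rule that(1))
  have ofree: "q (chart_from G v e t) = 0"
    if "oriented e v w g" "e \<in> edges G" "t \<in> {0..elen G e}" "u (chart_from G v e t) < \<epsilon>" for e v w g t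
    using free[OF chart_from_in_points[OF that(2) oriented_left(1)[OF that(1,2)] that(3)] that(4)] .
  let ?S = "{..<\<epsilon>} :: real set"
  have S: "open ?S" by simp
  have ES: "u x \<in> ?S" if "x \<in> E" for x using u_zero_on_E[OF E that] \<epsilon>(1) by simp
  note sum = has_sum_flux_cutoff[OF S ES]
  \<comment> \<open>With slope at most 0 at \<open>v\<close>, the function would stay below the
    level up to \<open>w\<close>, as \<open>q\<close> vanishes there. Then \<open>e\<close> lies in
    \<open>F\<close>, both end values are 0, and convexity contradicts \<open>u > 0\<close>
    inside.\<close>
  have source: "0 < g 0" if e: "e \<in> edges G" and or: "oriented e v w g"
    and v: "cutoff ?S v = 1" and w: "cutoff ?S w = 0" for e v w g
  proof (rule ccontr)
    assume g0: "\<not> 0 < g 0"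
    note sol = oriented_solution[OF or] and ends = oriented_ends[OF or] and nn = oriented_nonneg[OF or e]
    have uv: "u v < \<epsilon>" and cases: "\<epsilon> \<le> u w \<or> e \<in> F"
      using crossing_cases[OF or e v w] by auto
    have "u (chart_from G v e (elen G e)) < \<epsilon>"
      by (rule solution_decreasing_free[OF sol, where s = 0])
        (use nn ofree[OF or e] g0 uv elen_pos[OF e] ends in auto)
    then have uw: "u w < \<epsilon>" using ends by simp
    then have "e \<in> F" using cases by simp
    then have "u v = 0" "u w = 0" using \<epsilon>0(3) uv uw \<epsilon>(3) oriented_left(1,2)[OF or e] by auto
    then show False
      using oriented_le_max[OF or e, of "elen G e / 2"] oriented_midpoint(1-3)[OF or e] by simp
  qed
  have nonpos: "flux e (cutoff ?S) \<le> 0" if e: "e \<in> edges G" for e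
  proof (cases rule: flux_cutoff_cases[OF e, of ?S, case_names outside inside crossing])
    case (inside v w g)
    note sol = oriented_solution[OF inside(1)]
    have uvw: "u v < \<epsilon>" "u w < \<epsilon>" using inside(2,3) by (auto simp: cutoff_def split: if_splits)
    have "g (elen G e) = g 0"
    proof (rule solution_deriv_const[OF sol])
      fix t assume "0 < t" "t < elen G e"
      then show "q (chart_from G v e t) * u (chart_from G v e t) = 0"
        using ofree[OF inside(1) e, of t] oriented_le_max[OF inside(1) e, of t] uvw by simp
    qed (use elen_pos[OF e] in auto)
    with inside(4) show ?thesis by simp
  next
    case (crossing v w g)
    then show ?thesis using source[OF e crossing(1-3)] by simp
  qed simp
  have zero: "flux e (cutoff ?S) = 0" if e: "e \<in> edges G" for e
  proof -
    have "((\<lambda>e. - flux e (cutoff ?S)) has_sum - c) (edges G)" using sum by (simp add: has_sum_uminus)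
    from finite_sum_le_has_sum[OF this, of "{e}"] nonpos e neg show ?thesis by force
  qed
  have all1: "cutoff ?S v = 1" if "e \<in> edges G" "v \<in> ends G e" for e v
  proof (rule cutoff_all_1[OF S ES _ _ that])
    \<comment> \<open>From a point below the level, follow the edge in the direction in which
      \<open>u\<close> does not increase: without potential it stays below the level up to the end.
      The other direction uses the reflected solution.\<close>
    fix e t assume e: "e \<in> edges G" and t: "t \<in> {0..elen G e}" "u (chart G e t) \<in> ?S"
    have v: "chart G e 0 \<in> ends G e" by (simp add: ends_def)
    obtain w g where or: "oriented e (chart G e 0) w g" using oriented_exists[OF e v] .
    obtain w' g' where or': "oriented e w w' g'" using oriented_exists[OF e oriented_left(2)[OF or e]] .
    have "chart G e t \<in> chart_from G (chart G e 0) e ` {0..elen G e}"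
      using t(1) chart_from_image[OF v e] by simp
    then obtain s where s: "s \<in> {0..elen G e}" "chart G e t = chart_from G (chart G e 0) e s" by blast
    show "\<exists>v\<in>ends G e. u v \<in> ?S"
    proof (cases "g s \<le> 0")
      case True
      have "u (chart_from G (chart G e 0) e (elen G e)) < \<epsilon>"
        by (rule solution_decreasing_free[OF oriented_solution[OF or], where s = s])
          (use oriented_nonneg[OF or e] ofree[OF or e] True s t(2) in auto)
      then have "u w < \<epsilon>" using oriented_ends[OF or] by simp
      then show ?thesis using oriented_left(2)[OF or e] by blast
    next
      case False
      have "u (chart_from G (chart G e 0) e (elen G e - elen G e)) < \<epsilon>"
      proof (rule solution_decreasing_free[OF solution_reflect[OF oriented_solution[OF or]]])
        show "0 \<le> u (chart_from G (chart G e 0) e (elen G e - t))" if "t \<in> {0..elen G e}" for t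
          using oriented_nonneg[OF or e, of "elen G e - t"] that by simp
        show "q (chart_from G (chart G e 0) e (elen G e - t)) = 0"
          if "t \<in> {0..elen G e}" "u (chart_from G (chart G e 0) e (elen G e - t)) < \<epsilon>" for t
          using ofree[OF or e, of "elen G e - t"] that by simp
        show "elen G e - s \<in> {0..elen G e}" "elen G e \<in> {elen G e - s..elen G e}" using s(1) by auto
        show "u (chart_from G (chart G e 0) e (elen G e - (elen G e - s))) < \<epsilon>" using s t(2) by simp
        show "- g (elen G e - (elen G e - s)) \<le> 0" using False by simp
      qed
      then show ?thesis using v oriented_ends(1)[OF or] by auto
    qed
  next
    fix e v w g assume *: "e \<in> edges G" "oriented e v w g" "cutoff ?S v = 1"
    show "cutoff ?S w = 1"
    proof (rule ccontr)
      assume "cutoff ?S w \<noteq> 1"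
      then have w0: "cutoff ?S w = 0" by (simp add: cutoff_def split: if_splits)
      then have "flux e (cutoff ?S) = - g 0" using flux_oriented[OF *(2)] *(3) by simp
      then show False using source[OF * w0] zero[OF *(1)] by simp
    qed
  qed
  have below: "u x \<le> \<epsilon>" if x: "x \<in> points G" for x
  proof -
    obtain e t where e: "e \<in> edges G" "t \<in> {0..elen G e}" "x = chart G e t" using point_on_edge[OF x] .
    obtain v where v: "v \<in> ends G e" "u x \<le> u v" using edge_le_max[OF e(1)] e by blast
    have "u v < \<epsilon>" using all1[OF e(1) v(1)] by (simp add: cutoff_def split: if_splits)
    with v(2) show ?thesis by simp
  qed
  obtain y where "y \<in> \<Omega>" using \<Omega>_nonempty by blast
  then have "y \<in> boundary G" using \<Omega>_subset by blast
  then have "u y = 1" and yg: "y \<in> gbar G"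
    using u_boundary[of y] \<open>y \<in> \<Omega>\<close> subsetD[OF boundary_subset_gbar] by simp_all
  have "u y \<le> \<epsilon>"
    using continuous_le_on_closure[of "points G" u y \<epsilon>] continuous_u yg below by (simp add: gbar_def)
  with \<open>u y = 1\<close> \<epsilon>(2) show False by simp
qed

end

lemma dn_settingI:
  fixes G :: "('a::metric_space, 'e) mgraph"
  assumes "metric_graph G" "graph_connected G" "has_completion G" "boundary G \<noteq> {}"
    and "admissible_potential G q" "compact (gbar G)"
    and "clopen_in_boundary G \<Omega>" "\<Omega> \<noteq> {}" "\<Omega> \<noteq> boundary G"
    and "clopen_in_boundary G E" "E \<noteq> {}"
    and "dn_value G q (indicator \<Omega>) E c"
  obtains u \<phi> F where "dn_setting G q u \<Omega> \<phi> E c F"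
proof -
  have sub: "\<Omega> \<subseteq> boundary G" "E \<subseteq> boundary G"
    using assms(7,10) openin_imp_subset unfolding clopen_in_boundary_def by blast+
  from assms(12) obtain u \<phi> where 1: "harmonic_extension G q (indicator \<Omega>) u" "\<phi> \<in> test_algebra G"
    "\<forall>x\<in>E. \<phi> x = 1" "\<forall>x\<in>boundary G - E. \<phi> x = 0"
    "c = graph_integral G (\<lambda>e t. u (chart G e t) * schroedinger G q \<phi> e t)"
    unfolding dn_value_def by blast
  from 1(2) obtain F where "finite F" "F \<subseteq> edges G"
    "\<forall>e\<in>edges G - F. \<forall>t\<in>{0<..<elen G e}. deriv (\<lambda>s. \<phi> (chart G e s)) t = 0"
    unfolding test_algebra_def by blast
  with 1 assms sub have "dn_setting G q u \<Omega> \<phi> E c F" by unfold_locales auto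
  then show thesis by (rule that)
qed

theorem theorem4p4:
  fixes G :: "('a::metric_space, 'e) mgraph"
    and q :: "'a \<Rightarrow> real"
    and \<Omega> E1 E2 :: "'a set"
  assumes "metric_graph G" and "graph_connected G" and "has_completion G"
    and "boundary G \<noteq> {}"
    and "admissible_potential G q"
    and "weakly_connected G" and "compact (gbar G)"
    and "clopen_in_boundary G \<Omega>" and "\<Omega> \<noteq> {}" and "\<Omega> \<noteq> boundary G"
    and "clopen_in_boundary G E1" and "E1 \<noteq> {}" and "E1 \<subseteq> \<Omega>"
    and "clopen_in_boundary G E2" and "E2 \<noteq> {}" and "E2 \<subseteq> boundary G - \<Omega>"
  shows "(\<forall>c. dn_value G q (indicator \<Omega>) E1 c \<longrightarrow> 0 < c) \<and>
         (\<forall>c. dn_value G q (indicator \<Omega>) E2 c \<longrightarrow> c \<le> 0) \<and>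
         ((\<exists>N. openin (top_of_set (gbar G)) N \<and> boundary G \<subseteq> N \<and> (\<forall>x\<in>N \<inter> points G. q x = 0)) \<longrightarrow>
            (\<forall>c. dn_value G q (indicator \<Omega>) E2 c \<longrightarrow> c < 0))"
proof (intro conjI allI impI)
  note setting = dn_settingI[OF assms(1-5,7-10)]
  fix c
  show "0 < c" if "dn_value G q (indicator \<Omega>) E1 c"
    using setting[OF assms(11,12) that] dn_setting.dn_pos[OF _ assms(13)] by metis
  show "c \<le> 0" if "dn_value G q (indicator \<Omega>) E2 c"
    using setting[OF assms(14,15) that] dn_setting.dn_nonpos[OF _ assms(16)] by metis
  assume "\<exists>N. openin (top_of_set (gbar G)) N \<and> boundary G \<subseteq> N \<and> (\<forall>x\<in>N \<inter> points G. q x = 0)"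
  then obtain N where N: "openin (top_of_set (gbar G)) N" "boundary G \<subseteq> N" "\<forall>x\<in>N \<inter> points G. q x = 0"
    by blast
  assume "dn_value G q (indicator \<Omega>) E2 c"
  then obtain u \<phi> F where "dn_setting G q u \<Omega> \<phi> E2 c F"
    using setting[OF assms(14,15)] by blast
  then show "c < 0" using dn_setting.dn_neg[OF _ assms(16) N(1,2)] N(3) by blast
qed

end
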